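(* The matrix $P_B^\perp\Omega P_B^\perp\ne0$ if and only if $N_R<N$ (i.e., $R$ is rank deficient), and in this case the following statements are true: 1. The nonzero eigenvalues of $P_B^\perp\Omega P_B^\perp$ are real and come in $\pm$ pairs with equal multiplicity. In particular, $0\in\sigma(P_B^\perp\Omega P_B^\perp)=-\sigma(P_B^\perp\Omega P_B^\perp)\subseteq\mathbb R$. 2. The operator $\Omega_1$ is self-adjoint with respect to the standard inner product, the operator $P_R^\perp\alpha P_R^\perp|_{\operatorname{Ker}R}:\operatorname{Ker}R\to\operatorname{Ker}R$ is invertible, and for every $\rho\in\mathbb C$, $$\det(\rho\mathbf 1-\Omega_1)=\rho^{N_R}\,\frac{\det\big[P_R^\perp C(\rho,0)P_R^\perp|_{\operatorname{Ker}R}\big]}{\det\big(P_R^\perp\alpha P_R^\perp|_{\operatorname{Ker}R}\big)}.$$ In particular, $\sigma(P_B^\perp\Omega P_B^\perp)=\sigma(\Omega_1)=\{\rho\in\mathbb C:\det[P_R^\perp C(\rho,0)P_R^\perp|_{\operatorname{Ker}R}]=0\}\cup\{0\}$. 3. If $\rho_0\ne0$ is an eigenvalue of $P_B^\perp\Omega P_B^\perp$, then its multiplicity equals its multiplicity as an eigenvalue of $\Omega_1$, which equals the order of the zero at $\rho=\rho_0$ of the polynomial (of degree $2N-2N_R$) $\det[P_R^\perp C(\rho,0)P_R^\perp|_{\operatorname{Ker}R}]$. 4. The eigenvalue $0$ of $\Omega_1$ has multiplicity $N_R$ if and only if $\operatorname{Ker}R\cap\operatorname{Ker}\eta=\{0\}$,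 in which case $$\dim\operatorname{Ker}\Omega_1=N_R,\qquad \dim\operatorname{Ran}(P_B^\perp\Omega P_B^\perp)=\dim\operatorname{Ran}\Omega_1=2(N-N_R).$$ 5. If $\eta>0$ then: (i) $0$ is an eigenvalue of both $\Omega_1^\flat$ and $\Omega_1$, of equal multiplicity $N_R$; (ii) $P_R^\perp C(\rho,0)P_R^\perp|_{\operatorname{Ker}R}=-\rho^2P_R^\perp C^\flat(-\rho^{-1},0)P_R^\perp|_{\operatorname{Ker}R}$ for $\rho\ne0$; (iii) $\rho\ne0$ is an eigenvalue of $\Omega_1$ of multiplicity $m$ if and only if $-\rho^{-1}$ is an eigenvalue of $\Omega_1^\flat$ of multiplicity $m$. In particular, with $\rho_{\min}=\min[\sigma(\Omega_1)\cap(0,\infty)]$, $\rho_{\max}=\max\sigma(\Omega_1)$, and $\rho_{\min}^\flat,\rho_{\max}^\flat$ the same quantities for $\Omega_1^\flat$, $$\rho_{\min}^\flat=\rho_{\max}^{-1},\qquad \rho_{\max}^\flat=\rho_{\min}^{-1}.$$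
   Context: Setting. $N\ge 1$; $\alpha,\eta,\theta,R$ are real $N\times N$ matrices with $\alpha^{\mathrm T}=\alpha>0$, $\eta^{\mathrm T}=\eta\ge0$, $\theta^{\mathrm T}=-\theta$, $R^{\mathrm T}=R\ge0$, and $N_R=\operatorname{rank}R>0$. $\sqrt{\cdot}$ denotes the positive semidefinite square root. On $\mathbb C^{2N}=\mathbb C^N\oplus\mathbb C^N$ (standard inner product) set $$\Omega=\begin{bmatrix}-2\mathrm i\sqrt\alpha^{-1}\theta\sqrt\alpha^{-1} & -\mathrm i\Phi^{\mathrm T}\\ \mathrm i\Phi&0\end{bmatrix},\quad \Phi=\sqrt\eta\sqrt\alpha^{-1},\quad B=\begin{bmatrix}\sqrt\alpha^{-1}R\sqrt\alpha^{-1}&0\\0&0\end{bmatrix}.$$ The quadratic matrix pencil is $C(\zeta,\beta)=\zeta^2\alpha+(2\theta+\beta R)\mathrm i\zeta-\eta$, so $C(\rho,0)=\rho^2\alpha+2\mathrm i\rho\theta-\eta$. $P_B^\perp$ is the orthogonal projection of $\mathbb C^{2N}$ onto $\operatorname{Ker}B$, $P_R^\perp$ the orthogonal projection of $\mathbb C^N$ onto $\operatorname{Ker}R$. $\Omega_1=P_B^\perp\Omega P_B^\perp|_{\operatorname{Ker}B}:\operatorname{Ker}B\to\operatorname{Ker}B$. $\det$ of an operator on a finite-dimensional complex space is the product of its eigenvalues with multiplicity; $M|_{\operatorname{Ker}R}$ denotes the restriction to $\operatorname{Ker}R$, regarded as an operator $\operatorname{Ker}R\to\operatorname{Ker}R$.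 When $\eta>0$, objects with superscript $\flat$ ($\Omega^\flat,B^\flat,\Omega_1^\flat,C^\flat$) are defined as those without it but with $\alpha$ and $\eta$ interchanged; e.g. $C^\flat(\zeta,\beta)=\zeta^2\eta+(2\theta+\beta R)\mathrm i\zeta-\alpha$.
   Formalization: The opening equivalence fails (N=2, α=1, η=θ=0, R=diag(1,0) gives Ω=0). Proved instead: the compression is nonzero iff N_R<N and not (Ker R ⊆ Ker η and P_R^⊥θP_R^⊥=0); the printed equivalence is proved when Ker R∩Ker η={0}. Items 1–5 hold whenever N_R<N. *)

theory Defs
  imports "HOL-Analysis.Analysis" "HOL-Computational_Algebra.Polynomial"
begin

definition pos_def :: "real^'n^'n \<Rightarrow> bool" where
  "pos_def A \<longleftrightarrow> (\<forall>x. x \<noteq> 0 \<longrightarrow> x \<bullet> (A *v x) > 0)"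

definition pos_semidef :: "real^'n^'n \<Rightarrow> bool" where
  "pos_semidef A \<longleftrightarrow> (\<forall>x. x \<bullet> (A *v x) \<ge> 0)"

text \<open>A symmetric positive semidefinite matrix has exactly one symmetric positive
  semidefinite square root; on other matrices the value is unspecified.\<close>

definition psd_sqrt :: "real^'n^'n \<Rightarrow> real^'n^'n" where
  "psd_sqrt A = (THE S. transpose S = S \<and> pos_semidef S \<and> S ** S = A)"

text \<open>The inner product \<open>\<bullet>\<close> of the type class on \<^typ>\<open>complex^'m\<close> is only the real
  part of the standard Hermitian one.\<close>

definition cinner :: "complex^'m \<Rightarrow> complex^'m \<Rightarrow> complex" where
  "cinner x y = (\<Sum>i\<in>UNIV. cnj (x $ i) * y $ i)"

definition cmat :: "real^'n^'m \<Rightarrow> complex^'n^'m" where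
  "cmat = map_matrix complex_of_real"

definition smult_mat :: "complex \<Rightarrow> complex^'n^'m \<Rightarrow> complex^'n^'m" (infixr "*\<^sub>m" 75) where
  "c *\<^sub>m A = map_matrix ((*) c) A"

definition block_mat ::
  "'a^'n^'n \<Rightarrow> 'a^'m^'n \<Rightarrow> 'a^'n^'m \<Rightarrow> 'a^'m^'m \<Rightarrow> 'a^('n + 'm)^('n + 'm)" where
  "block_mat A B C D = (\<chi> i j. case i of
      Inl k \<Rightarrow> (case j of Inl l \<Rightarrow> A $ k $ l | Inr l \<Rightarrow> B $ k $ l)
    | Inr k \<Rightarrow> (case j of Inl l \<Rightarrow> C $ k $ l | Inr l \<Rightarrow> D $ k $ l))"

definition ker :: "complex^'n^'m \<Rightarrow> (complex^'n) set" where
  "ker A = {x. A *v x = 0}"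

text \<open>The matrix of the orthogonal projection onto the subspace \<open>V\<close>.\<close>

definition orth_proj :: "(complex^'m) set \<Rightarrow> complex^'m^'m" where
  "orth_proj V = (THE P. \<forall>x. P *v x \<in> V \<and> (\<forall>y\<in>V. cinner y (x - P *v x) = 0))"

text \<open>An operator \<open>V \<rightarrow> V\<close> on a complex subspace \<open>V\<close> is represented by a function on the
  ambient space that maps \<open>V\<close> into itself linearly; the notions below depend only on its
  restriction to \<open>V\<close>. For the operator on the whole space given by a matrix, take
  \<open>V = UNIV\<close>.\<close>

definition spectrum_on :: "(complex^'m) set \<Rightarrow> (complex^'m \<Rightarrow> complex^'m) \<Rightarrow> complex set" where
  "spectrum_on V T = {\<mu>. \<exists>v\<in>V. v \<noteq> 0 \<and> T v = \<mu> *s v}"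

text \<open>Algebraic multiplicity, i.e. the dimension of the generalized eigenspace
  (\<open>0\<close> if the number is not an eigenvalue).\<close>

definition eig_mult ::
  "(complex^'m) set \<Rightarrow> (complex^'m \<Rightarrow> complex^'m) \<Rightarrow> complex \<Rightarrow> nat" where
  "eig_mult V T \<mu> = vec.dim {v\<in>V. \<exists>k. ((\<lambda>w. T w - \<mu> *s w) ^^ k) v = 0}"

definition det_on :: "(complex^'m) set \<Rightarrow> (complex^'m \<Rightarrow> complex^'m) \<Rightarrow> complex" where
  "det_on V T = (\<Prod>\<mu>\<in>spectrum_on V T. \<mu> ^ eig_mult V T \<mu>)"

definition self_adjoint_on :: "(complex^'m) set \<Rightarrow> (complex^'m \<Rightarrow> complex^'m) \<Rightarrow> bool" where
  "self_adjoint_on V T \<longleftrightarrow> T ` V \<subseteq> V \<and> (\<forall>x\<in>V. \<forall>y\<in>V. cinner (T x) y = cinner x (T y))"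

text \<open>Interchanging the arguments \<open>\<alpha>\<close> and \<open>\<eta>\<close> below yields the objects with
  superscript \<open>\<flat>\<close>.\<close>

definition Phi_mat :: "real^'n^'n \<Rightarrow> real^'n^'n \<Rightarrow> real^'n^'n" where
  "Phi_mat \<alpha> \<eta> = psd_sqrt \<eta> ** matrix_inv (psd_sqrt \<alpha>)"

definition Omega_mat ::
  "real^'n^'n \<Rightarrow> real^'n^'n \<Rightarrow> real^'n^'n \<Rightarrow> complex^('n + 'n)^('n + 'n)" where
  "Omega_mat \<alpha> \<eta> \<theta> = block_mat
     ((-2 * \<i>) *\<^sub>m cmat (matrix_inv (psd_sqrt \<alpha>) ** \<theta> ** matrix_inv (psd_sqrt \<alpha>)))
     ((- \<i>) *\<^sub>m cmat (transpose (Phi_mat \<alpha> \<eta>)))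
     (\<i> *\<^sub>m cmat (Phi_mat \<alpha> \<eta>))
     0"

definition B_mat :: "real^'n^'n \<Rightarrow> real^'n^'n \<Rightarrow> complex^('n + 'n)^('n + 'n)" where
  "B_mat \<alpha> R = block_mat
     (cmat (matrix_inv (psd_sqrt \<alpha>) ** R ** matrix_inv (psd_sqrt \<alpha>))) 0
     0 0"

definition pencil ::
  "real^'n^'n \<Rightarrow> real^'n^'n \<Rightarrow> real^'n^'n \<Rightarrow> real^'n^'n \<Rightarrow> complex \<Rightarrow> complex \<Rightarrow> complex^'n^'n" where
  "pencil \<alpha> \<eta> \<theta> R \<zeta> \<beta> =
     \<zeta>\<^sup>2 *\<^sub>m cmat \<alpha> + (\<i> * \<zeta>) *\<^sub>m (2 *\<^sub>m cmat \<theta> + \<beta> *\<^sub>m cmat R) - cmat \<eta>"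

definition P_B :: "real^'n^'n \<Rightarrow> real^'n^'n \<Rightarrow> complex^('n + 'n)^('n + 'n)" where
  "P_B \<alpha> R = orth_proj (ker (B_mat \<alpha> R))"

definition P_R :: "real^'n^'n \<Rightarrow> complex^'n^'n" where
  "P_R R = orth_proj (ker (cmat R))"

definition compressed_Omega ::
  "real^'n^'n \<Rightarrow> real^'n^'n \<Rightarrow> real^'n^'n \<Rightarrow> real^'n^'n \<Rightarrow> complex^('n + 'n)^('n + 'n)" where
  "compressed_Omega \<alpha> \<eta> \<theta> R = P_B \<alpha> R ** Omega_mat \<alpha> \<eta> \<theta> ** P_B \<alpha> R"

text \<open>To be considered on the subspace \<^term>\<open>ker (B_mat \<alpha> R)\<close> only.\<close>

definition Omega1 ::
  "real^'n^'n \<Rightarrow> real^'n^'n \<Rightarrow> real^'n^'n \<Rightarrow> real^'n^'n \<Rightarrow>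
   complex^('n + 'n) \<Rightarrow> complex^('n + 'n)" where
  "Omega1 \<alpha> \<eta> \<theta> R v = compressed_Omega \<alpha> \<eta> \<theta> R *v v"

definition spectrum_Omega1 ::
  "real^'n^'n \<Rightarrow> real^'n^'n \<Rightarrow> real^'n^'n \<Rightarrow> real^'n^'n \<Rightarrow> complex set" where
  "spectrum_Omega1 \<alpha> \<eta> \<theta> R = spectrum_on (ker (B_mat \<alpha> R)) (Omega1 \<alpha> \<eta> \<theta> R)"

definition mult_Omega1 ::
  "real^'n^'n \<Rightarrow> real^'n^'n \<Rightarrow> real^'n^'n \<Rightarrow> real^'n^'n \<Rightarrow> complex \<Rightarrow> nat" where
  "mult_Omega1 \<alpha> \<eta> \<theta> R = eig_mult (ker (B_mat \<alpha> R)) (Omega1 \<alpha> \<eta> \<theta> R)"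

definition compressed_pencil_det ::
  "real^'n^'n \<Rightarrow> real^'n^'n \<Rightarrow> real^'n^'n \<Rightarrow> real^'n^'n \<Rightarrow> complex \<Rightarrow> complex" where
  "compressed_pencil_det \<alpha> \<eta> \<theta> R \<rho> =
     det_on (ker (cmat R)) ((*v) (P_R R ** pencil \<alpha> \<eta> \<theta> R \<rho> 0 ** P_R R))"

text \<open>Meaningful only when the sets are finite and nonempty.\<close>

definition rho_min :: "real^'n^'n \<Rightarrow> real^'n^'n \<Rightarrow> real^'n^'n \<Rightarrow> real^'n^'n \<Rightarrow> real" where
  "rho_min \<alpha> \<eta> \<theta> R = Min {x. complex_of_real x \<in> spectrum_Omega1 \<alpha> \<eta> \<theta> R \<and> 0 < x}"

definition rho_max :: "real^'n^'n \<Rightarrow> real^'n^'n \<Rightarrow> real^'n^'n \<Rightarrow> real^'n^'n \<Rightarrow> real" where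
  "rho_max \<alpha> \<eta> \<theta> R = Max {x. complex_of_real x \<in> spectrum_Omega1 \<alpha> \<eta> \<theta> R}"

end

theory Submission
  imports Defs "HOL-Computational_Algebra.Fundamental_Theorem_Algebra"
begin

text \<open>Both determinants are restrictions of ordinary ones: an operator on \<open>V\<close> is extended by the
  identity on a complement, and the order of a root of the characteristic polynomial is the dimension
  of the generalized eigenspace. Write \<open>a = \<surd>\<alpha>\<close>, \<open>q\<close> and \<open>k\<close> for the projections onto \<open>Ker R\<close> and
  onto \<open>Ker (a\<^sup>-\<^sup>1 R a\<^sup>-\<^sup>1) = a Ker R\<close>. A Schur complement with respect to the second block of
  \<open>\<rho> - \<Omega>\<^sub>1\<close> turns its determinant into \<open>\<rho>^N\<^sub>R\<close> times that of \<open>k a\<^sup>-\<^sup>1 C(\<rho>,0) a\<^sup>-\<^sup>1 k\<close> on the range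
  of \<open>k\<close>, and the congruence by \<open>a q + a\<^sup>-\<^sup>1 (1 - q)\<close>, which maps \<open>Ker R\<close> onto the range of \<open>k\<close> and the
  orthogonal complement onto the orthogonal complement, brings it to the compression of \<open>C(\<rho>,0)\<close> to
  \<open>Ker R\<close> divided by that of \<open>\<alpha>\<close>. Hence, up to a constant, the characteristic polynomial of the
  compression of \<open>\<Omega>\<close> is \<open>\<rho>^(2 N\<^sub>R)\<close> times the determinant of the compressed pencil, and every claim
  about multiplicities is read off this polynomial identity.\<close>

section \<open>Determinants and generalized eigenspaces\<close>

text \<open>\<open>det_on\<close> is defined through eigenvalues and comes with no product rule, so
  every factorization is carried out on full-size matrices whose extra part is the identity; the
  additional eigenvalue \<open>1\<close> does not change a product. A Schur complement divides by
  \<open>x\<close>, so the identities are first obtained for nonzero \<open>x\<close> and reach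
  \<open>x = 0\<close>, on which the multiplicity of the eigenvalue \<open>0\<close> depends, only
  as identities of polynomials. The summand \<open>b (1 - q)\<close> of the congruence, with
  \<open>b\<close> the inverse of \<open>a\<close>, is dictated by orthogonality:
  \<open><a q x, b (1 - q) y> = <q x, (1 - q) y> = 0\<close>, although \<open>a\<close> itself need
  not respect the splitting. The determinants that this congruence introduces are never computed;
  the case \<open>X = \<alpha>\<close>, in which the compression becomes the identity, eliminates
  them and is the origin of the denominator in the determinant formula. Interchanging \<alpha> and
  \<eta> sends a root to its negative reciprocal; the extremal eigenvalues can be compared because
  the spectrum is symmetric about \<open>0\<close>.\<close>

lemma mat_mult_vec [simp]: "mat c *v x = c *s (x :: 'a::comm_ring_1^'n)"
  by (simp add: vec_eq_iff matrix_vector_mult_def mat_def if_distrib[of "\<lambda>c. c * _"] cong: if_cong)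

lemma minus_matrix_vector [simp]: "(- A) *v x = - (A *v (x :: 'a::comm_ring_1^'n))"
  by (simp add: vec_eq_iff matrix_vector_mult_def sum_negf)

lemma smult_mat_vec [simp]: "(c *\<^sub>m A) *v x = c *s (A *v x)"
  by (simp add: smult_mat_def vec_eq_iff matrix_vector_mult_def sum_distrib_left mult_ac)

lemmas matvec = matrix_vector_mul_assoc [symmetric] matrix_vector_mult_add_rdistrib
  matrix_vector_mult_diff_rdistrib matrix_vector_right_distrib matrix_vector_mult_diff_distrib
  vec.scale vec.neg

lemma matrix_eqI: "(\<And>x. A *v x = B *v (x :: 'a::field^'n)) \<Longrightarrow> A = B"
  by (simp add: matrix_eq)

lemma det_nz_iff_ker: "det (A :: 'a::field^'n^'n) \<noteq> 0 \<longleftrightarrow> (\<forall>x. A *v x = 0 \<longrightarrow> x = 0)"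
  by (metis invertible_det_nz invertible_left_inverse matrix_left_invertible_ker)

section \<open>Idempotents and complements of subspaces\<close>

definition coord_proj :: "'n set \<Rightarrow> 'a::field^'n^'n" where
  "coord_proj A = (\<chi> i j. if i = j \<and> i \<in> A then 1 else 0)"

lemma coord_proj_vec: "coord_proj A *v x = (\<chi> i. if i \<in> A then x $ i else 0)"
proof -
  have "(\<Sum>j\<in>UNIV. (if i = j \<and> i \<in> A then 1 else 0) * x $ j) = (if i \<in> A then x $ i else 0)" for i
    by (cases "i \<in> A") (simp_all add: if_distrib[of "\<lambda>c. c * _"] cong: if_cong)
  then show ?thesis by (simp add: vec_eq_iff matrix_vector_mult_def coord_proj_def)
qed

lemma coord_proj_vec_idem [simp]: "coord_proj A *v (coord_proj A *v x) = coord_proj A *v x"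
  by (simp add: coord_proj_vec vec_eq_iff)

lemma coord_proj_complement: "mat 1 - coord_proj A = coord_proj (- A)"
  by (rule matrix_eqI) (simp add: matvec coord_proj_vec vec_eq_iff)

lemma range_coord_proj: "range ((*v) (coord_proj A :: 'a::field^'n^'n)) = {x. \<forall>i. i \<notin> A \<longrightarrow> x $ i = 0}"
proof (intro equalityI subsetI)
  fix x :: "'a^'n" assume "x \<in> {x. \<forall>i. i \<notin> A \<longrightarrow> x $ i = 0}"
  then have "x = coord_proj A *v x" by (simp add: coord_proj_vec vec_eq_iff)
  then show "x \<in> range ((*v) (coord_proj A))" by blast
qed (auto simp: coord_proj_vec)

lemma det_scale_coord_proj:
  "det (mat x ** coord_proj A + (mat 1 - coord_proj A) :: 'a::field^'n^'n) = x ^ card A"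
proof -
  have *: "mat x ** coord_proj A + (mat 1 - coord_proj A) =
      (\<chi> i j. if i = j then (if i \<in> A then x else 1) else 0 :: 'a^'n^'n)" (is "_ = ?D")
  proof (rule matrix_eqI)
    fix v :: "'a^'n"
    have "(\<Sum>j\<in>UNIV. (if i = j then if i \<in> A then x else 1 else 0) * v $ j) = (if i \<in> A then x * v $ i else v $ i)" for i
      by (cases "i \<in> A") (simp_all add: if_distrib[of "\<lambda>c. c * _"] cong: if_cong)
    then have "?D *v v = (\<chi> i. if i \<in> A then x * v $ i else v $ i)"
      by (simp add: vec_eq_iff matrix_vector_mult_def)
    then show "(mat x ** coord_proj A + (mat 1 - coord_proj A)) *v v = ?D *v v"
      by (simp add: matvec coord_proj_vec vec_eq_iff)
  qed
  have "det ?D = (\<Prod>i\<in>UNIV. ?D $ i $ i)" by (rule det_diagonal) simp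
  also have "\<dots> = x ^ card A" by (simp add: prod.If_cases)
  finally show ?thesis using * by simp
qed

lemma range_conj_coord_proj:
  fixes S S' :: "'a::field^'n^'n"
  assumes "S' ** S = mat 1"
  shows "range ((*v) (S ** coord_proj A ** S')) = (*v) S ` range ((*v) (coord_proj A))"
proof (intro equalityI subsetI)
  fix x assume "x \<in> (*v) S ` range ((*v) (coord_proj A))"
  then obtain y where "x = S *v (coord_proj A *v y)" by blast
  then have "x = (S ** coord_proj A ** S') *v (S *v y)"
    by (metis assms matrix_vector_mul_assoc matrix_vector_mul_lid)
  then show "x \<in> range ((*v) (S ** coord_proj A ** S'))" by blast
qed (auto simp: matvec)

lemma conj_coord_proj:
  fixes S S' :: "'a::field^'n^'n"
  assumes SS: "S ** S' = mat 1" "S' ** S = mat 1" and E: "E = S ** coord_proj A ** S'"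
  shows conj_coord_proj_idem: "E ** E = E"
    and conj_coord_proj_det: "det (mat x ** E + (mat 1 - E)) = x ^ card A"
    and conj_coord_proj_dim: "vec.dim (range ((*v) E)) = card A"
    and conj_coord_proj_complement: "mat 1 - E = S ** coord_proj (- A) ** S'"
proof -
  have s: "S *v (S' *v v) = v" "S' *v (S *v v) = v" for v
    by (simp_all add: matrix_vector_mul_assoc SS)
  show "E ** E = E"
    by (rule matrix_eqI) (simp add: E matvec s)
  have "mat x ** E + (mat 1 - E) = S ** (mat x ** coord_proj A + (mat 1 - coord_proj A)) ** S'"
    by (rule matrix_eqI) (simp add: E matvec s)
  moreover have "det S * det S' = 1" by (metis SS(1) det_I det_mul)
  ultimately show "det (mat x ** E + (mat 1 - E)) = x ^ card A"
    by (simp add: det_mul det_scale_coord_proj mult_ac)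
  show "mat 1 - E = S ** coord_proj (- A) ** S'"
    by (rule matrix_eqI) (simp add: E matvec s flip: coord_proj_complement)
  have "vec.dim ((*v) S ` X) = vec.dim X" for X
    by (rule vec.dim_image_eq) (auto intro: inj_on_inverseI[of _ "(*v) S'"] simp: s)
  then show "vec.dim (range ((*v) E)) = card A"
    by (simp add: E range_conj_coord_proj[OF SS(2)] range_coord_proj dim_substandard_cart)
qed

text \<open>A basis of \<open>G\<close> is extended to a basis of the whole space, and
  \<open>S\<close> carries the standard basis to it; \<open>A\<close> collects the indices whose
  images belong to the basis of \<open>G\<close>.\<close>

lemma subspace_eq_conj_coord_proj:
  fixes G :: "('a::field^'n) set"
  assumes G: "vec.subspace G"
  obtains S S' :: "'a^'n^'n" and A where "S ** S' = mat 1" "S' ** S = mat 1" "card A = vec.dim G"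
    "G = range ((*v) (S ** coord_proj A ** S'))"
proof -
  obtain B where B: "B \<subseteq> G" "vec.independent B" "G \<subseteq> vec.span B" "card B = vec.dim G"
    using vec.basis_exists by blast
  define C where "C = vec.extend_basis B"
  have C: "B \<subseteq> C" "vec.independent C" "vec.span C = UNIV"
    using vec.extend_basis_superset[OF B(2)] vec.independent_extend_basis[OF B(2)]
      vec.span_extend_basis[OF B(2)] by (auto simp: C_def)
  obtain g :: "'a^'n \<Rightarrow> 'a^'n" where g: "Vector_Spaces.linear (*s) (*s) g" "bij g" "bij_betw g cart_basis C"
    using vec.basis_change_exists'[OF independent_cart_basis C(2) span_cart_basis C(3) refl] by blast
  define S where "S = matrix g"
  have Sg: "(*v) S = g" unfolding S_def by (simp add: matrix_works g(1))
  have "invertible S" using invertible_eq_bij[of S] g(2) Sg by simp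
  then obtain S' where SS: "S ** S' = mat 1" "S' ** S = mat 1" by (auto simp: invertible_def)
  define A where "A = {i. g (axis i 1) \<in> B}"
  have "(\<lambda>i. g (axis i 1)) ` A = B"
    using C(1) bij_betw_imp_surj_on[OF g(3)] by (auto simp: A_def cart_basis_def image_iff)
  then have gB: "B = g ` ((\<lambda>i. axis i 1) ` A)" by (simp add: image_image)
  have "vec.span ((\<lambda>i. axis i 1) ` A) = range ((*v) (coord_proj A :: 'a^'n^'n))" (is "?L = ?R")
  proof
    show "?L \<subseteq> ?R"
      by (rule vec.span_minimal)
        (auto simp: range_coord_proj vec.subspace_def axis_def)
    show "?R \<subseteq> ?L"
    proof
      fix x assume "x \<in> ?R"
      then have x: "x $ i = 0" if "i \<notin> A" for i using that by (auto simp: range_coord_proj)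
      have "x = (\<Sum>i\<in>UNIV. x $ i *s axis i 1)" by (simp add: basis_expansion)
      also have "\<dots> = (\<Sum>i\<in>A. x $ i *s axis i 1)"
        by (rule sum.mono_neutral_right) (auto simp: x)
      also have "\<dots> \<in> ?L" by (intro vec.span_sum vec.span_scale vec.span_base) auto
      finally show "x \<in> ?L" .
    qed
  qed
  moreover have "G = vec.span B" using B G by (metis vec.span_subspace)
  moreover have "vec.span (g ` X) = g ` vec.span X" for X
    using g(1) by (rule vec.linear_span_image)
  ultimately have "G = (*v) S ` range ((*v) (coord_proj A))" by (simp add: gB Sg)
  also have "\<dots> = range ((*v) (S ** coord_proj A ** S'))"
    by (simp only: range_conj_coord_proj[OF SS(2)])
  finally have *: "G = range ((*v) (S ** coord_proj A ** S'))" .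
  moreover have "card A = vec.dim G" using conj_coord_proj_dim[OF SS refl] * by simp
  ultimately show ?thesis using SS that by blast
qed

text \<open>Any complement will do, and no inner product is involved, so this also serves
  generalized eigenspaces of matrices that are not Hermitian. The determinant clause turns the
  dimension of \<open>G\<close> into an exponent.\<close>

lemma ex_idempotent:
  fixes G :: "('a::field^'n) set"
  assumes "vec.subspace G"
  obtains E :: "'a^'n^'n" where "E ** E = E" "range ((*v) E) = G"
    "\<And>x. det (mat x ** E + (mat 1 - E)) = x ^ vec.dim G"
    "vec.dim (range ((*v) (mat 1 - E))) = CARD('n) - vec.dim G"
proof -
  obtain S S' :: "'a^'n^'n" and A where SS: "S ** S' = mat 1" "S' ** S = mat 1" "card A = vec.dim G"
    "G = range ((*v) (S ** coord_proj A ** S'))"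
    by (rule subspace_eq_conj_coord_proj[OF assms])
  define E where "E = S ** coord_proj A ** S'"
  note * = conj_coord_proj[OF SS(1,2) E_def]
  have "vec.dim (range ((*v) (mat 1 - E))) = card (- A)"
    using conj_coord_proj_dim[OF SS(1,2) *(4)] .
  then show ?thesis using that[of E] * SS(3,4) E_def by (simp add: Compl_eq_Diff_UNIV card_Diff_subset)
qed

text \<open>Rank-nullity: with \<open>E\<close> projecting onto the kernel, \<open>M\<close> is
  injective on the range of \<open>mat 1 - E\<close> and has its full image there.\<close>

lemma dim_range_matrix:
  fixes M :: "'a::field^'n^'m"
  shows "vec.dim (range ((*v) M)) = CARD('n) - vec.dim {x. M *v x = 0}"
proof -
  have "vec.subspace {x. M *v x = 0}" by (auto simp: vec.subspace_def matvec)
  then obtain E where E: "E ** E = E" "range ((*v) E) = {x. M *v x = 0}"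
    "vec.dim (range ((*v) (mat 1 - E))) = CARD('n) - vec.dim {x. M *v x = 0}"
    by (rule ex_idempotent)
  have ME: "M *v (E *v x) = 0" for x using E(2) by blast
  then have "range ((*v) M) = (*v) M ` range ((*v) (mat 1 - E))"
    by (auto simp: image_image matvec)
  moreover have "vec.dim ((*v) M ` range ((*v) (mat 1 - E))) = vec.dim (range ((*v) (mat 1 - E)))"
  proof (rule vec.dim_image_eq)
    have "vec.span (range ((*v) (mat 1 - E))) = range ((*v) (mat 1 - E))"
      by (metis matrix_vector_mul_linear_gen vec.linear_span_image vec.span_UNIV)
    moreover have "inj_on ((*v) M) (range ((*v) (mat 1 - E)))"
    proof (rule inj_onI)
      fix x y assume xy: "x \<in> range ((*v) (mat 1 - E))" "y \<in> range ((*v) (mat 1 - E))" "M *v x = M *v y"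
      from xy(3) have "x - y \<in> range ((*v) E)" by (simp add: E matvec)
      moreover have "E *v (E *v z) = E *v z" for z by (simp add: matrix_vector_mul_assoc E)
      ultimately have "E *v (x - y) = x - y" by auto
      moreover have "E *v x = 0" "E *v y = 0" using xy(1,2) \<open>\<And>z. E *v (E *v z) = E *v z\<close> by (auto simp: matvec)
      ultimately show "x = y" by (simp add: matvec)
    qed
    ultimately show "inj_on ((*v) M) (vec.span (range ((*v) (mat 1 - E))))" by (simp only:)
  qed auto
  ultimately show ?thesis using E by simp
qed

section \<open>Polynomial determinants and splitting off the generalized kernel\<close>

lemma poly_det: "poly (det P) x = det (map_matrix (\<lambda>p. poly p x) (P :: 'a::comm_ring_1 poly^'n^'n))"
  by (simp add: det_def poly_sum poly_prod)


lemma mat_mult_component: "(mat x ** A) $ i $ j = x * (A :: 'a::comm_ring_1^'n^'n) $ i $ j"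
  by (simp add: matrix_matrix_mult_def mat_def if_distrib[of "\<lambda>c. c * _"] cong: if_cong)

lemma ex_poly_det_affine:
  fixes A B :: "'a::comm_ring_1^'n^'n"
  obtains p where "\<And>x. poly p x = det (mat x ** A + B)"
proof
  fix x
  have "mat x ** A + B = map_matrix (\<lambda>p. poly p x) (\<chi> i j. [:B $ i $ j, A $ i $ j:])"
    by (simp add: vec_eq_iff mat_mult_component add.commute)
  then show "poly (det (\<chi> i j. [:B $ i $ j, A $ i $ j:])) x = det (mat x ** A + B)"
    by (simp add: poly_det)
qed

text \<open>Multiplying both sides by the variable makes them agree at \<open>0\<close> as
  well.\<close>

lemma poly_eqI_nonzero:
  fixes p q :: "'a::field_char_0 poly"
  assumes "\<And>x. x \<noteq> 0 \<Longrightarrow> poly p x = poly q x"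
  shows "p = q"
proof -
  have "poly ([:0, 1:] * p) x = poly ([:0, 1:] * q) x" for x
    using assms by (cases "x = 0") auto
  then have "[:0, 1:] * p = [:0, 1:] * q" by (metis poly_eq_poly_eq_iff ext)
  then show ?thesis by (metis mult_cancel_left one_neq_zero pCons_eq_0_iff)
qed

text \<open>The hypothesis is nilpotency in the form that there are no nonzero eigenvalues,
  \<open>y\<close> being the reciprocal of a would-be eigenvalue. No nilpotency index is needed to
  check it.\<close>

lemma det_one_minus_nilpotent:
  fixes N :: "complex^'n^'n"
  assumes "\<And>y v. v = y *s (N *v v) \<Longrightarrow> v = 0"
  shows "det (mat 1 - mat y ** N) = 1"
proof -
  obtain p where p: "\<And>x. poly p x = det (mat x ** (- N) + mat 1)"
    by (rule ex_poly_det_affine) blast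
  \<comment> \<open>A polynomial in \<open>y\<close> without complex zeros is constant.\<close>
  have "poly p x \<noteq> 0" for x
    unfolding p det_nz_iff_ker
  proof (intro allI impI)
    fix v assume "(mat x ** (- N) + mat 1) *v v = 0"
    then have "v = x *s (N *v v)" by (simp add: matvec vector_smult_rneg)
    then show "v = 0" by (rule assms)
  qed
  then have "constant (poly p)" using fundamental_theorem_of_algebra by blast
  then have "poly p y = poly p 0" by (simp add: constant_def)
  moreover have "det (mat 1 - mat y ** N) = poly p y"
    unfolding p by (rule arg_cong[where f = det], rule matrix_eqI) (simp add: matvec vector_smult_rneg)
  moreover have "poly p 0 = 1" by (simp add: p)
  ultimately show ?thesis by simp
qed

lemma det_one_plus_square_zero:
  fixes W :: "complex^'n^'n"
  assumes "W ** W = 0"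
  shows "det (mat 1 + W) = 1"
proof -
  have "det (mat 1 - mat (- 1) ** W) = 1"
  proof (rule det_one_minus_nilpotent)
    fix y v assume v: "v = y *s (W *v v)"
    have "W *v (W *v v) = 0" by (simp add: matrix_vector_mul_assoc assms)
    moreover have "W *v v = y *s (W *v (W *v v))" by (subst v) (simp add: matvec)
    ultimately show "v = 0" using v by simp
  qed
  moreover have "mat 1 - mat (- 1) ** W = mat 1 + W"
    by (rule matrix_eqI) (simp add: matvec vector_smult_lneg)
  ultimately show ?thesis by simp
qed

text \<open>The hypothesis on \<open>X\<close> says that the range of \<open>E\<close> is invariant,
  so \<open>X\<close> is block triangular. It is the product of its lower right block, a unipotent
  matrix \<open>mat 1 + W\<close> carrying the off-diagonal block, and its upper left block, each
  completed by the identity.\<close>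

lemma det_block_triangular:
  fixes E X :: "complex^'n^'n"
  assumes E: "E ** E = E" and X: "E ** X ** E = X ** E"
  shows "det X = det (E + (mat 1 - E) ** X ** (mat 1 - E)) * det (X ** E + (mat 1 - E))"
proof -
  define W where "W = E ** X ** (mat 1 - E)"
  have e: "E *v (E *v v) = E *v v" "E *v (X *v (E *v v)) = X *v (E *v v)" for v
    using E X by (metis matrix_vector_mul_assoc)+
  have "X = (E + (mat 1 - E) ** X ** (mat 1 - E)) ** (mat 1 + W) ** (X ** E + (mat 1 - E))"
    by (rule matrix_eqI) (simp add: W_def matvec e)
  then have "det X = det (E + (mat 1 - E) ** X ** (mat 1 - E)) * det (mat 1 + W) * det (X ** E + (mat 1 - E))"
    by (metis det_mul)
  moreover have "det (mat 1 + W) = 1"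
    by (rule det_one_plus_square_zero, rule matrix_eqI) (simp add: W_def matvec e)
  ultimately show ?thesis by simp
qed

lemma funpow_linear:
  fixes f :: "'a::field^'n \<Rightarrow> 'a^'n"
  assumes "\<And>v w. f (v + w) = f v + f w" "\<And>c v. f (c *s v) = c *s f v"
  shows "(f ^^ k) (v + w) = (f ^^ k) v + (f ^^ k) w" "(f ^^ k) (c *s v) = c *s (f ^^ k) v"
proof -
  show "(f ^^ k) (v + w) = (f ^^ k) v + (f ^^ k) w"
    by (induction k) (simp_all add: assms)
  show "(f ^^ k) (c *s v) = c *s (f ^^ k) v"
    by (induction k) (simp_all add: assms)
qed

text \<open>On \<open>G\<close> the matrix is nilpotent, which yields the power of \<open>x\<close>;
  modulo \<open>G\<close> it is injective, which keeps the cofactor \<open>r\<close> from vanishing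
  at \<open>0\<close>.\<close>

lemma det_factor_generalized_kernel:
  fixes M :: "complex^'n^'n"
  defines "G \<equiv> {v. \<exists>k. ((*v) M ^^ k) v = 0}"
  obtains r where "poly r 0 \<noteq> 0" "\<And>x. det (mat x - M) = x ^ vec.dim G * poly r x"
proof -
  have lin: "((*v) M ^^ k) (v + w) = ((*v) M ^^ k) v + ((*v) M ^^ k) w"
    "((*v) M ^^ k) (c *s v) = c *s ((*v) M ^^ k) v" for k v w c
    by (rule funpow_linear; simp add: matvec)+
  have zero: "((*v) M ^^ k) 0 = 0" for k by (induction k) auto
  have mono: "((*v) M ^^ (j + k)) v = 0" if "((*v) M ^^ k) v = 0" for j k v
    using that zero by (simp add: funpow_add)
  have "vec.subspace G"
    unfolding vec.subspace_def
  proof (intro conjI allI ballI)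
    show "0 \<in> G" using zero by (auto simp: G_def)
    fix v w :: "complex^'n" and c assume "v \<in> G"
    then obtain k where k: "((*v) M ^^ k) v = 0" by (auto simp: G_def)
    then show "c *s v \<in> G" using lin(2)[of k c v] by (auto simp: G_def)
    assume "w \<in> G"
    then obtain j where j: "((*v) M ^^ j) w = 0" by (auto simp: G_def)
    have "((*v) M ^^ (j + k)) (v + w) = 0"
      using mono[OF k, of j] mono[OF j, of k] by (simp add: lin add.commute)
    then show "v + w \<in> G" by (auto simp: G_def)
  qed
  then obtain E :: "complex^'n^'n" where E: "E ** E = E" "range ((*v) E) = G"
    "\<And>x. det (mat x ** E + (mat 1 - E)) = x ^ vec.dim G"
    by (rule ex_idempotent) blast
  have EE: "E *v (E *v v) = E *v v" for v by (simp add: matrix_vector_mul_assoc E)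
  have fix_G: "E *v v = v" if "v \<in> G" for v using that EE unfolding E(2)[symmetric] by auto
  have MG: "M *v v \<in> G \<longleftrightarrow> v \<in> G" for v
  proof
    assume "M *v v \<in> G"
    then obtain k where "((*v) M ^^ k) (M *v v) = 0" by (auto simp: G_def)
    then have "((*v) M ^^ Suc k) v = 0" by (simp add: funpow_swap1)
    then show "v \<in> G" unfolding G_def by blast
  next
    assume "v \<in> G"
    then obtain k where k: "((*v) M ^^ k) v = 0" by (auto simp: G_def)
    then have "((*v) M ^^ k) (M *v v) = 0" by (metis funpow_swap1 matrix_vector_mult_0_right)
    then show "M *v v \<in> G" by (auto simp: G_def)
  qed
  have EG: "E *v v \<in> G" for v using E(2) by blast
  have EME: "E *v (M *v (E *v v)) = M *v (E *v v)" for v by (simp add: fix_G MG EG)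
  \<comment> \<open>Chosen so that \<open>x (1 - E) + K\<close> is the identity on \<open>G\<close>
    and the compression of \<open>x - M\<close> on the complement; the determinant of this matrix is
    the cofactor.\<close>
  define K where "K = E - (mat 1 - E) ** M ** (mat 1 - E)"
  obtain r where r: "\<And>x. poly r x = det (mat x ** (mat 1 - E) + K)"
    by (rule ex_poly_det_affine) blast
  obtain f where f: "\<And>x. poly f x = det (mat x ** mat 1 + (- M))"
    by (rule ex_poly_det_affine) blast
  have f': "poly f x = det (mat x - M)" for x by (simp add: f)
  have nilp: "det (mat 1 - mat y ** (M ** E)) = 1" for y
  proof (rule det_one_minus_nilpotent)
    fix y v assume v: "v = y *s ((M ** E) *v v)"
    \<comment> \<open>\<open>v\<close> is a multiple of \<open>M E v\<close> and \<open>M\<close>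
      preserves \<open>G\<close>, so \<open>v\<close> lies in \<open>G\<close> and some power of
      \<open>M\<close> kills it.\<close>
    have "E *v v = v" by (subst (1 2) v) (simp add: matvec EME)
    then have "v \<in> G" using EG[of v] by simp
    then obtain k where k: "((*v) M ^^ k) v = 0" by (auto simp: G_def)
    have v': "v = y *s (M *v v)" using v \<open>E *v v = v\<close> by (simp add: matvec)
    have "v = y ^ j *s ((*v) M ^^ j) v" for j
    proof (induction j)
      case (Suc j)
      have "v = y *s (M *v (y ^ j *s ((*v) M ^^ j) v))" using v' Suc by simp
      then show ?case by (simp add: matvec)
    qed simp
    from this[of k] show "v = 0" using k by simp
  qed
  have "poly f x = poly (monom 1 (vec.dim G) * r) x" if "x \<noteq> 0" for x
  proof -
    have "det (mat x - M) = det (E + (mat 1 - E) ** (mat x - M) ** (mat 1 - E)) *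
        det ((mat x - M) ** E + (mat 1 - E))"
      by (rule det_block_triangular[OF E(1)], rule matrix_eqI) (simp add: matvec EME EE)
    also have "E + (mat 1 - E) ** (mat x - M) ** (mat 1 - E) = mat x ** (mat 1 - E) + K"
      by (rule matrix_eqI) (simp add: matvec EE K_def)
    also have "(mat x - M) ** E + (mat 1 - E) =
        (mat x ** E + (mat 1 - E)) ** (mat 1 - mat (1 / x) ** (M ** E))"
      using that by (intro matrix_eqI) (simp add: matvec EME vec.scale_right_diff_distrib)
    finally show ?thesis by (simp add: f' r det_mul nilp E(3) poly_monom mult.commute)
  qed
  then have "f = monom 1 (vec.dim G) * r" by (rule poly_eqI_nonzero)
  then have "det (mat x - M) = x ^ vec.dim G * poly r x" for x
    using f'[of x] by (simp add: poly_monom)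
  moreover have "poly r 0 \<noteq> 0"
    unfolding r det_nz_iff_ker
  proof (intro allI impI)
    fix v assume "(mat 0 ** (mat 1 - E) + K) *v v = 0"
    \<comment> \<open>The right-hand side lies in the range of \<open>mat 1 - E\<close>, so both
      sides must vanish.\<close>
    then have *: "E *v v = (M *v (v - E *v v)) - E *v (M *v (v - E *v v))"
      by (simp add: K_def matvec algebra_simps)
    then have "E *v v = 0"
      by (metis (no_types, lifting) EE cancel_comm_monoid_add_class.diff_cancel matrix_vector_mult_diff_distrib)
    with * have "M *v v = E *v (M *v v)" by simp
    then have "M *v v \<in> G" using EG by metis
    then have "v = E *v v" by (simp add: MG fix_G)
    then show "v = 0" using \<open>E *v v = 0\<close> by simp
  qed
  ultimately show ?thesis by (rule that[rotated])
qed

section \<open>The characteristic polynomial; the determinant as a product of eigenvalues\<close>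

definition charpoly :: "complex^'n^'n \<Rightarrow> complex poly" where
  "charpoly M = det (\<chi> i j. [:- M $ i $ j, if i = j then 1 else 0:])"

lemma poly_charpoly: "poly (charpoly M) x = det (mat x - M)"
proof -
  have "mat x - M = map_matrix (\<lambda>p. poly p x) (\<chi> i j. [:- M $ i $ j, if i = j then 1 else 0:])"
    by (simp add: vec_eq_iff mat_def)
  then show ?thesis by (simp add: poly_det charpoly_def)
qed

lemma det_mat: "det (mat x :: 'a::field^'n^'n) = x ^ CARD('n)"
  using det_scale_coord_proj[of x "UNIV :: 'n set"] by (simp add: coord_proj_def mat_def[symmetric])

text \<open>Away from \<open>0\<close>, \<open>det (x - M) = x^n g (1/x)\<close> with
  \<open>g y = det (1 - y M)\<close> and \<open>g 0 = 1\<close>. A degree below \<open>n\<close>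
  would make \<open>g\<close> vanish at \<open>0\<close>, a degree above \<open>n\<close> would make
  the reversed characteristic polynomial vanish there, whose value is the leading
  coefficient.\<close>

lemma charpoly_monic:
  fixes M :: "complex^'n^'n"
  shows degree_charpoly: "degree (charpoly M) = CARD('n)"
    and lead_coeff_charpoly: "lead_coeff (charpoly M) = 1"
proof -
  obtain g where g: "\<And>y. poly g y = det (mat y ** (- M) + mat 1)"
    by (rule ex_poly_det_affine) blast
  let ?f = "charpoly M" and ?n = "CARD('n)"
  have f: "poly ?f x = x ^ ?n * poly g (inverse x)" if "x \<noteq> 0" for x
  proof -
    have "mat x - M = mat x ** (mat (inverse x) ** (- M) + mat 1)"
      using that by (intro matrix_eqI) (simp add: matvec vec.scale_right_distrib vector_smult_rneg)
    then show ?thesis by (simp add: poly_charpoly g det_mul det_mat)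
  qed
  have refl: "poly (reflect_poly ?f) y = y ^ degree ?f * (inverse y ^ ?n * poly g y)" if "y \<noteq> 0" for y
    using that f[of "inverse y"] by (simp add: poly_reflect_poly_nz)
  have g0: "poly g 0 = 1" by (simp add: g)
  have "degree ?f = ?n \<and> lead_coeff ?f = 1"
  proof (cases "degree ?f < ?n")
    case True
    have "monom 1 (?n - degree ?f) * reflect_poly ?f = g"
    proof (rule poly_eqI_nonzero)
      fix y :: complex assume "y \<noteq> 0"
      then show "poly (monom 1 (?n - degree ?f) * reflect_poly ?f) y = poly g y"
        using True by (simp add: poly_monom refl power_diff field_simps)
    qed
    then have "poly g 0 = 0" using True by (metis (no_types, lifting) mult_zero_left poly_monom power_0_left poly_mult mult_zero_right zero_less_diff less_irrefl)
    then show ?thesis using g0 by simp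
  next
    case False
    have *: "reflect_poly ?f = monom 1 (degree ?f - ?n) * g"
    proof (rule poly_eqI_nonzero)
      fix y :: complex assume "y \<noteq> 0"
      then show "poly (reflect_poly ?f) y = poly (monom 1 (degree ?f - ?n) * g) y"
        using False by (simp add: poly_monom refl power_diff field_simps)
    qed
    have "lead_coeff ?f = 0 ^ (degree ?f - ?n)"
      using arg_cong[OF *, of "\<lambda>p. poly p 0"] by (simp add: poly_monom g0)
    moreover have "?f \<noteq> 0"
    proof
      assume "?f = 0"
      then have "g = 0" using * by (metis monom_eq_0_iff mult_eq_0_iff reflect_poly_0 one_neq_zero)
      then show False using g0 by simp
    qed
    ultimately have "degree ?f - ?n = 0" by (metis leading_coeff_0_iff power_0_left)
    then show ?thesis using False \<open>lead_coeff ?f = 0 ^ _\<close> by simp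
  qed
  then show "degree ?f = ?n" "lead_coeff ?f = 1" by auto
qed

lemma charpoly_nonzero [simp]: "charpoly M \<noteq> 0"
  using lead_coeff_charpoly[of M] by auto

text \<open>The factorization for the generalized kernel of \<open>M - \<mu>\<close> is translated
  by \<open>\<mu>\<close>; its cofactor does not vanish there, so the exponent is the exact
  order.\<close>

lemma order_charpoly:
  fixes M :: "complex^'n^'n"
  shows "order \<mu> (charpoly M) = eig_mult UNIV ((*v) M) \<mu>"
proof -
  define d where "d = eig_mult UNIV ((*v) M) \<mu>"
  have shift: "(*v) (M - mat \<mu>) = (\<lambda>w. M *v w - \<mu> *s w)" by (rule ext) (simp add: matvec)
  obtain r where r: "poly r 0 \<noteq> 0" "\<And>x. det (mat x - (M - mat \<mu>)) = x ^ d * poly r x"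
    using det_factor_generalized_kernel[of "M - mat \<mu>"] unfolding shift d_def eig_mult_def by auto
  have "poly (charpoly M) x = poly ([:- \<mu>, 1:] ^ d * pcompose r [:- \<mu>, 1:]) x" for x
  proof -
    have "poly (charpoly M) x = det (mat (x - \<mu>) - (M - mat \<mu>))"
      unfolding poly_charpoly
      by (rule arg_cong[where f = det], rule matrix_eqI) (simp add: matvec vec.scale_left_diff_distrib)
    then show ?thesis by (simp add: r(2) poly_pcompose)
  qed
  then have *: "charpoly M = [:- \<mu>, 1:] ^ d * pcompose r [:- \<mu>, 1:]"
    by (metis poly_eq_poly_eq_iff ext)
  then have "[:- \<mu>, 1:] ^ d * pcompose r [:- \<mu>, 1:] \<noteq> 0" by (metis charpoly_nonzero)
  then show ?thesis
    unfolding * using r(1)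
    by (subst order_mult) (simp_all add: order_power_n_n order_0I poly_pcompose d_def)
qed

lemma spectrum_charpoly: "spectrum_on UNIV ((*v) M) = {\<mu>. poly (charpoly M) \<mu> = 0}"
proof -
  have "poly (charpoly M) \<mu> = 0 \<longleftrightarrow> (\<exists>v. v \<noteq> 0 \<and> M *v v = \<mu> *s v)" for \<mu>
  proof -
    have "poly (charpoly M) \<mu> = 0 \<longleftrightarrow> (\<exists>v. (mat \<mu> - M) *v v = 0 \<and> v \<noteq> 0)"
      using det_nz_iff_ker[of "mat \<mu> - M"] by (auto simp: poly_charpoly)
    also have "\<dots> \<longleftrightarrow> (\<exists>v. v \<noteq> 0 \<and> M *v v = \<mu> *s v)"
      by (simp add: matvec) metis
    finally show ?thesis .
  qed
  then show ?thesis by (simp add: spectrum_on_def)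
qed

lemma finite_spectrum: "finite (spectrum_on UNIV ((*v) M))"
  by (simp add: spectrum_charpoly poly_roots_finite)

text \<open>The factored characteristic polynomial is evaluated at \<open>0\<close>. The orders of
  its roots add up to the size of the matrix, so the signs on the two sides cancel.\<close>

theorem det_eq_det_on:
  fixes M :: "complex^'n^'n"
  shows "det M = det_on UNIV ((*v) M)"
proof -
  let ?f = "charpoly M" and ?n = "CARD('n)"
  let ?Z = "{z. poly ?f z = 0}"
  have dec: "(\<Prod>z\<in>?Z. [:- z, 1:] ^ order z ?f) = ?f"
    using complex_poly_decompose[of ?f] by (simp add: lead_coeff_charpoly)
  have "degree (\<Prod>z\<in>?Z. [:- z, 1:] ^ order z ?f) = (\<Sum>z\<in>?Z. order z ?f)"
    by (subst degree_prod_sum_eq) (auto simp: degree_power_eq)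
  then have deg: "(\<Sum>z\<in>?Z. order z ?f) = ?n" by (simp add: dec degree_charpoly)
  have "(-1) ^ ?n * det M = det (mat (-1) ** M)" by (simp add: det_mul det_mat)
  also have "mat (-1) ** M = mat 0 - M" by (rule matrix_eqI) (simp add: matvec vector_smult_lneg)
  also have "det (mat 0 - M) = poly ?f 0" by (simp add: poly_charpoly)
  also have "\<dots> = (\<Prod>z\<in>?Z. (- z) ^ order z ?f)"
    by (subst dec[symmetric]) (simp add: poly_prod poly_power)
  also have "\<dots> = (\<Prod>z\<in>?Z. (-1) ^ order z ?f * z ^ order z ?f)"
    by (intro prod.cong refl) (metis mult_minus1 power_mult_distrib)
  also have "\<dots> = (-1) ^ ?n * (\<Prod>z\<in>?Z. z ^ order z ?f)"
    by (simp add: prod.distrib deg power_sum[symmetric])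
  finally have "det M = (\<Prod>z\<in>?Z. z ^ order z ?f)" by simp
  then show ?thesis by (simp add: det_on_def spectrum_charpoly order_charpoly)
qed

text \<open>Modulo \<open>V\<close> the matrix \<open>N\<close> acts as multiplication by
  \<open>c\<close>. For \<open>\<mu>\<close> different from \<open>c\<close>, eigenvectors and
  generalized eigenvectors must therefore vanish modulo \<open>V\<close>, and the action outside
  \<open>V\<close> is invisible at \<open>\<mu>\<close>.\<close>

lemma eig_transfer:
  fixes E N :: "complex^'m^'m" and T :: "complex^'m \<Rightarrow> complex^'m"
  defines "V \<equiv> {v. E *v v = v}"
  assumes T: "\<And>v. v \<in> V \<Longrightarrow> N *v v = T v" "\<And>v. v \<in> V \<Longrightarrow> T v \<in> V"
    and quot: "\<And>v. N *v v - E *v (N *v v) = c *s (v - E *v v)"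
    and "\<mu> \<noteq> c"
  shows spectrum_transfer: "\<mu> \<in> spectrum_on UNIV ((*v) N) \<longleftrightarrow> \<mu> \<in> spectrum_on V T"
    and eig_mult_transfer: "eig_mult UNIV ((*v) N) \<mu> = eig_mult V T \<mu>"
proof -
  have "v \<in> V" if "N *v v = \<mu> *s v" for v
  proof -
    have "\<mu> *s (v - E *v v) = c *s (v - E *v v)"
      using quot[of v] that by (simp add: matvec vector_ssub_ldistrib)
    then have "(\<mu> - c) *s (v - E *v v) = 0" by (simp add: vec.scale_left_diff_distrib algebra_simps)
    then have "v - E *v v = 0" using \<open>\<mu> \<noteq> c\<close> by (metis vector_mul_eq_0 right_minus_eq)
    then show ?thesis by (simp add: V_def)
  qed
  then show "\<mu> \<in> spectrum_on UNIV ((*v) N) \<longleftrightarrow> \<mu> \<in> spectrum_on V T"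
    using T(1) by (simp add: spectrum_on_def) metis
  define D where "D = (\<lambda>w. N *v w - \<mu> *s w)"
  define D' where "D' = (\<lambda>w. T w - \<mu> *s w)"
  have q: "(D ^^ k) v - E *v ((D ^^ k) v) = (c - \<mu>) ^ k *s (v - E *v v)" for k v
  proof (induction k)
    case (Suc k)
    let ?u = "(D ^^ k) v"
    have "(D ^^ Suc k) v - E *v ((D ^^ Suc k) v) =
        (N *v ?u - E *v (N *v ?u)) - \<mu> *s (?u - E *v ?u)"
      by (simp add: D_def matvec vector_ssub_ldistrib)
    also have "\<dots> = (c - \<mu>) *s ((c - \<mu>) ^ k *s (v - E *v v))"
      unfolding quot Suc.IH by (rule vector_sub_rdistrib[symmetric])
    finally show ?case by (simp add: mult.commute)
  qed simp
  have "v \<in> V" if "(D ^^ k) v = 0" for k v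
    using q[of k v] that \<open>\<mu> \<noteq> c\<close> by (simp add: V_def)
  moreover have D_eq: "D u = D' u" if "u \<in> V" for u
    using T(1)[OF that] by (simp add: D_def D'_def)
  have D'_V: "D' u \<in> V" if "u \<in> V" for u
    using T(2)[OF that] that by (simp add: V_def D'_def matvec)
  have "(D ^^ k) v = (D' ^^ k) v \<and> (D ^^ k) v \<in> V" if "v \<in> V" for k v
    by (induction k) (use that D_eq D'_V in auto)
  ultimately have "{v \<in> UNIV. \<exists>k. (D ^^ k) v = 0} = {v \<in> V. \<exists>k. (D' ^^ k) v = 0}"
    by (metis (no_types, lifting) UNIV_I)
  then show "eig_mult UNIV ((*v) N) \<mu> = eig_mult V T \<mu>"
    by (simp add: eig_mult_def D_def D'_def)
qed

text \<open>With \<open>c = 1\<close> the only eigenvalue whose multiplicity may differ is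
  \<open>1\<close>, and it contributes the factor \<open>1\<close> to both products.\<close>

theorem det_on_eq_det:
  fixes E N :: "complex^'m^'m"
  assumes T: "\<And>v. E *v v = v \<Longrightarrow> N *v v = T v" "\<And>v. E *v v = v \<Longrightarrow> E *v T v = T v"
    and quot: "\<And>v. N *v v - E *v (N *v v) = v - E *v v"
  shows "det_on {v. E *v v = v} T = det N"
proof -
  let ?V = "{v. E *v v = v}"
  have sp: "\<mu> \<in> spectrum_on UNIV ((*v) N) \<longleftrightarrow> \<mu> \<in> spectrum_on ?V T"
    and em: "eig_mult UNIV ((*v) N) \<mu> = eig_mult ?V T \<mu>" if "\<mu> \<noteq> 1" for \<mu>
    using eig_transfer[where E = E and N = N and T = T and c = 1 and \<mu> = \<mu>] assms that by auto
  have "spectrum_on ?V T \<subseteq> spectrum_on UNIV ((*v) N)"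
    using T(1) by (auto simp: spectrum_on_def)
  then have fin: "finite (spectrum_on ?V T)" using finite_spectrum finite_subset by blast
  have "det N = (\<Prod>\<mu>\<in>spectrum_on UNIV ((*v) N) - {1}. \<mu> ^ eig_mult UNIV ((*v) N) \<mu>)"
    unfolding det_eq_det_on det_on_def
    by (rule prod.mono_neutral_right) (auto simp: finite_spectrum)
  also have "\<dots> = (\<Prod>\<mu>\<in>spectrum_on ?V T - {1}. \<mu> ^ eig_mult ?V T \<mu>)"
    by (intro prod.cong) (auto simp: sp em)
  also have "\<dots> = det_on ?V T"
    unfolding det_on_def by (rule prod.mono_neutral_left) (auto simp: fin)
  finally show ?thesis by simp
qed

section \<open>Real symmetric matrices\<close>

definition diag_mat :: "('n \<Rightarrow> 'a::zero) \<Rightarrow> 'a^'n^'n" where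
  "diag_mat d = (\<chi> i j. if i = j then d i else 0)"

lemma diag_mat_vec: "diag_mat d *v x = (\<chi> i. d i * (x $ i :: 'a::comm_ring_1))"
proof -
  have "(\<Sum>j\<in>UNIV. (if i = j then d i else 0) * x $ j) = d i * x $ i" for i
    by (simp add: if_distrib[of "\<lambda>c. c * _"] cong: if_cong)
  then show ?thesis by (simp add: vec_eq_iff matrix_vector_mult_def diag_mat_def)
qed

lemma diag_mat_zero: "diag_mat (\<lambda>i. 0) = 0"
  by (simp add: diag_mat_def vec_eq_iff)

lemma transpose_diag_mat [simp]: "transpose (diag_mat d) = diag_mat d"
  by (simp add: vec_eq_iff transpose_def diag_mat_def)

lemma transpose_coord_proj [simp]: "transpose (coord_proj A) = coord_proj A"
  by (auto simp: vec_eq_iff transpose_def coord_proj_def)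

lemma symmetric_inner:
  fixes A :: "real^'n^'n"
  assumes "transpose A = A"
  shows "x \<bullet> (A *v y) = (A *v x) \<bullet> y"
  by (metis assms dot_lmul_matrix vector_transpose_matrix)

text \<open>A unit vector maximizing the quadratic form on \<open>V\<close> is an eigenvector:
  otherwise a small step along the residual \<open>w = A x - l x\<close>, which stays in
  \<open>V\<close>, would increase the Rayleigh quotient.\<close>

lemma symmetric_eigenvector_in_subspace:
  fixes A :: "real^'n^'n"
  assumes A: "transpose A = A" and V: "subspace V" "V \<noteq> {0}"
    and inv: "\<And>x. x \<in> V \<Longrightarrow> A *v x \<in> V"
  obtains x l where "x \<in> V" "norm x = 1" "A *v x = l *\<^sub>R x"
proof -
  have "compact (sphere 0 1 \<inter> V)" by (simp add: closed_subspace V compact_Int_closed)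
  moreover have "sphere 0 1 \<inter> V \<noteq> {}"
  proof -
    obtain v where v: "v \<in> V" "v \<noteq> 0" using V subspace_0 by blast
    then have "(1 / norm v) *\<^sub>R v \<in> sphere 0 1 \<inter> V" by (simp add: V subspace_scale)
    then show ?thesis by blast
  qed
  moreover have "continuous_on (sphere 0 1 \<inter> V) (\<lambda>x. x \<bullet> (A *v x))"
    by (intro continuous_intros linear_continuous_on matrix_vector_mul_bounded_linear)
  ultimately obtain x where x: "x \<in> sphere 0 1 \<inter> V"
    and max: "\<And>y. y \<in> sphere 0 1 \<inter> V \<Longrightarrow> y \<bullet> (A *v y) \<le> x \<bullet> (A *v x)"
    using continuous_attains_sup[of "sphere 0 1 \<inter> V" "\<lambda>x. x \<bullet> (A *v x)"] by blast
  define l where "l = x \<bullet> (A *v x)"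
  have xx: "x \<bullet> x = 1" using x by (simp add: norm_eq_1)
  have le: "y \<bullet> (A *v y) \<le> l * (y \<bullet> y)" if "y \<in> V" for y
  proof (cases "y = 0")
    case False
    let ?z = "(1 / norm y) *\<^sub>R y"
    have "?z \<in> sphere 0 1 \<inter> V" using False that by (simp add: V subspace_scale)
    from max[OF this] have "(y \<bullet> (A *v y)) / (norm y)\<^sup>2 \<le> l"
      by (simp add: l_def matrix_vector_mult_scaleR power2_eq_square)
    then show ?thesis using False by (simp add: field_simps power2_norm_eq_inner)
  qed simp
  define w where "w = A *v x - l *\<^sub>R x"
  have wV: "w \<in> V" using x by (simp add: w_def V inv subspace_diff subspace_scale)
  have xw: "x \<bullet> w = 0" by (simp add: w_def inner_diff_right xx l_def)
  have wAx: "w \<bullet> (A *v x) = w \<bullet> w"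
    using xw by (simp add: w_def inner_diff_left inner_diff_right inner_commute xx l_def algebra_simps)
  have key: "2 * t * (w \<bullet> w) \<le> t\<^sup>2 * (l * (w \<bullet> w) - w \<bullet> (A *v w))" for t
  proof -
    have "x + t *\<^sub>R w \<in> V" using x wV by (simp add: V subspace_add subspace_scale)
    from le[OF this] have "(x + t *\<^sub>R w) \<bullet> (A *v (x + t *\<^sub>R w)) \<le> l * ((x + t *\<^sub>R w) \<bullet> (x + t *\<^sub>R w))" .
    moreover have "x \<bullet> (A *v w) = w \<bullet> w"
      using symmetric_inner[OF A, of x w] wAx by (simp add: inner_commute)
    ultimately show ?thesis using wAx xw xx l_def[symmetric]
      by (simp add: matvec matrix_vector_mult_scaleR inner_add_left inner_add_right inner_commute
          power2_eq_square algebra_simps)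
  qed
  have "w = 0"
  proof (rule ccontr)
    assume "w \<noteq> 0"
    define s where "s = w \<bullet> w"
    define c where "c = l * s - w \<bullet> (A *v w)"
    have s: "s > 0" using \<open>w \<noteq> 0\<close> by (simp add: s_def)
    \<comment> \<open>Small enough to beat the second-order term: \<open>key\<close> divided by
      \<open>t\<close> becomes \<open>2 s \<le> t c \<le> s\<close>.\<close>
    define t where "t = s / (\<bar>c\<bar> + 1)"
    have t: "t > 0" using s by (simp add: t_def add_nonneg_pos)
    have "2 * t * s \<le> t\<^sup>2 * c" using key[of t] by (simp add: s_def c_def)
    then have "2 * s \<le> t * c" using t by (simp add: power2_eq_square mult.assoc)
    also have "\<dots> \<le> t * (\<bar>c\<bar> + 1)" using t by (intro mult_left_mono) auto
    also have "\<dots> = s" by (simp add: t_def)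
    finally show False using s by simp
  qed
  then show ?thesis using that[of x l] x by (simp add: w_def)
qed

text \<open>Orthonormal eigenvectors are collected one at a time. Symmetry keeps the orthogonal
  complement of those already found invariant, and it is nonzero as long as there are fewer than
  \<open>CARD('n)\<close>.\<close>

theorem spectral_theorem:
  fixes A :: "real^'n^'n"
  assumes A: "transpose A = A"
  obtains U :: "real^'n^'n" and d where "U ** transpose U = mat 1" "transpose U ** U = mat 1"
    "A = U ** diag_mat d ** transpose U"
proof -
  define P where "P B \<longleftrightarrow> finite B \<and> pairwise orthogonal B \<and> (\<forall>x\<in>B. norm x = 1 \<and> (\<exists>l. A *v x = l *\<^sub>R x))" for B
  have "\<exists>B. P B \<and> card B = k" if "k \<le> CARD('n)" for k
    using that
  proof (induction k)
    case 0
    show ?case by (rule exI[of _ "{}"]) (simp add: P_def)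
  next
    case (Suc k)
    then obtain B where B: "P B" "card B = k" by auto
    define V where "V = {x. \<forall>b\<in>B. b \<bullet> x = 0}"
    have "dim B < DIM(real^'n)"
      using dim_le_card'[of B] B Suc.prems by (simp add: P_def)
    then obtain v where "v \<noteq> 0" "\<And>y. y \<in> span B \<Longrightarrow> orthogonal v y"
      using orthogonal_to_subspace_exists by blast
    then have "v \<in> V" by (auto simp: V_def orthogonal_def inner_commute span_base)
    moreover have "subspace V"
      by (auto simp: V_def subspace_def inner_add_right)
    moreover have "A *v x \<in> V" if "x \<in> V" for x
    proof -
      have "b \<bullet> (A *v x) = 0" if "b \<in> B" for b
        using B(1) \<open>x \<in> V\<close> that symmetric_inner[OF A, of b x] by (auto simp: P_def V_def)
      then show ?thesis by (simp add: V_def)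
    qed
    ultimately obtain x l where x: "x \<in> V" "norm x = 1" "A *v x = l *\<^sub>R x"
      using symmetric_eigenvector_in_subspace[OF A, of V] \<open>v \<noteq> 0\<close> by auto
    have "x \<notin> B" using x(1,2) by (auto simp: V_def norm_eq_1)
    moreover have "P (insert x B)"
      using B(1) x by (auto simp: P_def V_def pairwise_insert orthogonal_def inner_commute)
    ultimately show ?case
      using B by (intro exI[of _ "insert x B"]) (simp add: P_def)
  qed
  then obtain B where B: "P B" "card B = CARD('n)" by blast
  obtain f where f: "bij_betw f (UNIV :: 'n set) B"
    using B finite_same_card_bij[of "UNIV :: 'n set" B] by (auto simp: P_def)
  have fB: "f i \<in> B" for i using f by (auto simp: bij_betw_def)
  have on: "f i \<bullet> f j = (if i = j then 1 else 0)" for i j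
  proof (cases "i = j")
    case True
    then show ?thesis using B(1) fB[of i] by (simp add: P_def norm_eq_1)
  next
    case False
    then have "f i \<noteq> f j" using f by (auto simp: bij_betw_def inj_on_def)
    then show ?thesis using B(1) fB False by (auto simp: P_def pairwise_def orthogonal_def)
  qed
  have "\<forall>i. \<exists>l. A *v f i = l *\<^sub>R f i" using B(1) fB by (auto simp: P_def)
  then obtain d where d: "\<And>i. A *v f i = d i *\<^sub>R f i" by metis
  define U :: "real^'n^'n" where "U = (\<chi> i j. f j $ i)"
  have UU: "transpose U ** U = mat 1"
    using on by (simp add: vec_eq_iff matrix_matrix_mult_def transpose_def U_def mat_def inner_vec_def)
  then have UU': "U ** transpose U = mat 1" by (simp add: matrix_left_right_inverse)
  have "A ** U = U ** diag_mat d"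
  proof -
    have "(A ** U) $ i $ j = (A *v f j) $ i" for i j
      by (simp add: matrix_matrix_mult_def matrix_vector_mult_def U_def)
    moreover have "(U ** diag_mat d) $ i $ j = f j $ i * d j" for i j
      by (simp add: matrix_matrix_mult_def U_def diag_mat_def if_distrib[of "\<lambda>c. _ * c"] cong: if_cong)
    ultimately show ?thesis by (simp add: vec_eq_iff d)
  qed
  then have "A = U ** diag_mat d ** transpose U"
    by (metis UU' matrix_mul_assoc matrix_mul_rid)
  with UU' UU show ?thesis by (rule that)
qed

lemma conj_diag_mult:
  fixes U :: "'a::field^'n^'n"
  assumes "transpose U ** U = mat 1"
  shows "(U ** diag_mat d ** transpose U) ** (U ** diag_mat e ** transpose U) =
    U ** diag_mat (\<lambda>i. d i * e i) ** transpose U"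
proof (rule matrix_eqI)
  have "transpose U *v (U *v x) = x" for x by (simp only: matrix_vector_mul_assoc assms matrix_vector_mul_lid)
  then show "((U ** diag_mat d ** transpose U) ** (U ** diag_mat e ** transpose U)) *v x =
      (U ** diag_mat (\<lambda>i. d i * e i) ** transpose U) *v x" for x
    by (simp add: matvec diag_mat_vec mult.assoc del: transpose_matrix_vector)
qed

section \<open>Positive semidefinite square roots\<close>

lemma pos_semidef_conj_diag:
  fixes U :: "real^'n^'n"
  assumes "\<And>i. d i \<ge> 0"
  shows "pos_semidef (U ** diag_mat d ** transpose U)"
  unfolding pos_semidef_def
proof
  fix x
  define y where "y = transpose U *v x"
  have "x \<bullet> ((U ** diag_mat d ** transpose U) *v x) = y \<bullet> (diag_mat d *v y)"
    by (simp add: y_def matvec dot_lmul_matrix del: vector_transpose_matrix)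
  also have "\<dots> = (\<Sum>i\<in>UNIV. d i * (y $ i)\<^sup>2)"
    by (simp add: diag_mat_vec inner_vec_def power2_eq_square mult_ac)
  finally show "0 \<le> x \<bullet> ((U ** diag_mat d ** transpose U) *v x)"
    by (simp add: assms sum_nonneg)
qed

text \<open>On an eigenvector \<open>u\<close> of \<open>S\<close> the equation reads
  \<open>(T + s i) (T - s i) u = 0\<close>. For \<open>w = (T - s i) u\<close> both terms of
  \<open><w, T w> + s i <w, w> = 0\<close> are nonnegative, so \<open>w = 0\<close> if
  \<open>s i > 0\<close>; if \<open>s i = 0\<close>, then
  \<open><T u, T u> = <u, T (T u)> = 0\<close>.\<close>

lemma psd_sqrt_unique:
  fixes S T :: "real^'n^'n"
  assumes S: "transpose S = S" "pos_semidef S" and T: "transpose T = T" "pos_semidef T"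
    and eq: "S ** S = T ** T"
  shows "S = T"
proof -
  obtain U :: "real^'n^'n" and s where U: "U ** transpose U = mat 1" "transpose U ** U = mat 1"
    "S = U ** diag_mat s ** transpose U"
    by (rule spectral_theorem[OF S(1)])
  have "S ** U = T ** U"
  proof -
    have "S *v column i U = T *v column i U" for i
    proof -
      define u where "u = column i U"
      have "S ** U = U ** diag_mat s" by (metis U(2,3) matrix_mul_assoc matrix_mul_rid)
      then have "S *v u = U *v (diag_mat s *v axis i 1)"
        by (metis matrix_vector_mul_assoc matrix_vector_mult_basis u_def)
      moreover have "diag_mat s *v axis i 1 = s i *\<^sub>R axis i 1"
        by (simp add: diag_mat_vec vec_eq_iff axis_def)
      ultimately have Su: "S *v u = s i *\<^sub>R u"
        by (simp add: matrix_vector_mult_scaleR matrix_vector_mult_basis u_def)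
      have uu: "u \<bullet> u = 1"
        using U(2) by (metis norm_eq_1 orthogonal_matrix orthogonal_matrix_orthonormal_columns u_def)
      have "s i = u \<bullet> (S *v u)" by (simp add: Su uu)
      then have s: "s i \<ge> 0" using S(2) by (simp add: pos_semidef_def)
      have "T *v (T *v u) = S *v (S *v u)" by (simp add: matrix_vector_mul_assoc eq)
      then have TT: "T *v (T *v u) = (s i * s i) *\<^sub>R u" by (simp add: Su matrix_vector_mult_scaleR)
      define w where "w = T *v u - s i *\<^sub>R u"
      have "T *v w + s i *\<^sub>R w = 0"
        by (simp add: w_def matvec matrix_vector_mult_scaleR TT scaleR_diff_right)
      then have "w \<bullet> (T *v w) + s i * (w \<bullet> w) = 0"
        by (metis inner_add_right inner_scaleR_right inner_zero_right)
      moreover have "w \<bullet> (T *v w) \<ge> 0" using T(2) by (simp add: pos_semidef_def)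
      moreover have "s i * (w \<bullet> w) \<ge> 0" using s by simp
      ultimately have "s i * (w \<bullet> w) = 0" by linarith
      then have "w = 0"
      proof (cases "s i = 0")
        case True
        have "(T *v u) \<bullet> (T *v u) = 0"
          using symmetric_inner[OF T(1), of u "T *v u"] TT True by simp
        then show ?thesis by (simp add: w_def True)
      qed auto
      then show ?thesis using Su by (simp add: w_def u_def)
    qed
    then show ?thesis
      by (simp add: vec_eq_iff matrix_matrix_mult_def matrix_vector_mult_def column_def)
  qed
  then show ?thesis by (metis U(1) matrix_mul_assoc matrix_mul_rid)
qed

lemma psd_sqrt:
  fixes A :: "real^'n^'n"
  assumes A: "transpose A = A" "pos_semidef A"
  shows transpose_psd_sqrt: "transpose (psd_sqrt A) = psd_sqrt A"
    and pos_semidef_psd_sqrt: "pos_semidef (psd_sqrt A)"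
    and psd_sqrt_square: "psd_sqrt A ** psd_sqrt A = A"
proof -
  obtain U :: "real^'n^'n" and d where U: "U ** transpose U = mat 1" "transpose U ** U = mat 1"
    "A = U ** diag_mat d ** transpose U"
    by (rule spectral_theorem[OF A(1)])
  have d: "d i \<ge> 0" for i
  proof -
    let ?u = "U *v axis i 1"
    have "transpose U *v ?u = axis i 1" by (simp only: matrix_vector_mul_assoc U matrix_vector_mul_lid)
    then have "?u \<bullet> (A *v ?u) = axis i 1 \<bullet> (diag_mat d *v axis i 1)"
      by (metis (no_types, opaque_lifting) U(3) dot_lmul_matrix matrix_vector_mul_assoc
          transpose_matrix_vector)
    also have "\<dots> = d i" by (simp add: diag_mat_vec inner_axis')
    finally show ?thesis using A(2) unfolding pos_semidef_def by metis
  qed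
  define S where "S = U ** diag_mat (\<lambda>i. sqrt (d i)) ** transpose U"
  have S: "transpose S = S" "pos_semidef S" "S ** S = A"
  proof -
    show "transpose S = S" by (simp add: S_def matrix_transpose_mul matrix_mul_assoc)
    show "pos_semidef S" unfolding S_def by (rule pos_semidef_conj_diag) (simp add: d)
    show "S ** S = A" unfolding S_def conj_diag_mult[OF U(2)] U(3) by (simp add: d)
  qed
  have "psd_sqrt A = S"
    unfolding psd_sqrt_def
  proof (rule the_equality)
    fix T assume "transpose T = T \<and> pos_semidef T \<and> T ** T = A"
    then show "T = S" using psd_sqrt_unique[of T S] S by metis
  qed (use S in simp)
  then show "transpose (psd_sqrt A) = psd_sqrt A" "pos_semidef (psd_sqrt A)" "psd_sqrt A ** psd_sqrt A = A"
    using S by auto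
qed

section \<open>Complexification and kernel projections\<close>

lemma cmat_mult: "cmat (A ** B) = cmat A ** cmat B"
  by (simp add: cmat_def vec_eq_iff matrix_matrix_mult_def)

lemma cmat_arith [simp]: "cmat (A + B) = cmat A + cmat B" "cmat (A - B) = cmat A - cmat B"
  "cmat (- A) = - cmat A" "cmat 0 = 0" "cmat (mat x) = mat (of_real x)"
  "cmat (transpose A) = transpose (cmat A)" "cmat (coord_proj I) = coord_proj I"
  by (simp_all add: cmat_def vec_eq_iff mat_def transpose_def coord_proj_def)

lemma cmat_eq_iff [simp]: "cmat A = cmat B \<longleftrightarrow> A = B"
  by (simp add: cmat_def vec_eq_iff)

lemma cinner_arith: "cinner x (y + z) = cinner x y + cinner x z" "cinner x (y - z) = cinner x y - cinner x z"
  "cinner (y - z) x = cinner y x - cinner z x"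
  "cinner x (c *s y) = c * cinner x y" "cinner (c *s x) y = cnj c * cinner x y"
  by (simp_all add: cinner_def sum.distrib sum_subtractf sum_distrib_left algebra_simps)

lemma cinner_zero [simp]: "cinner x 0 = 0" "cinner 0 x = 0"
  by (simp_all add: cinner_def)

lemma cinner_self_eq_0 [simp]: "cinner x x = 0 \<longleftrightarrow> x = 0"
proof
  assume "cinner x x = 0"
  have "cinner x x = of_real (\<Sum>i\<in>UNIV. (cmod (x $ i))\<^sup>2)"
    by (simp add: cinner_def complex_norm_square mult.commute del: of_real_power)
  then have "(\<Sum>i\<in>UNIV. (cmod (x $ i))\<^sup>2) = 0" using \<open>cinner x x = 0\<close> by (metis of_real_eq_0_iff)
  then show "x = 0" by (simp add: sum_nonneg_eq_0_iff vec_eq_iff)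
qed simp

lemma cinner_transpose: "cinner (cmat A *v x) y = cinner x (cmat (transpose A) *v y)"
proof -
  have "cinner (cmat A *v x) y = (\<Sum>i\<in>UNIV. \<Sum>j\<in>UNIV. of_real (A $ i $ j) * cnj (x $ j) * y $ i)"
    by (simp add: cinner_def matrix_vector_mult_def cmat_def sum_distrib_right)
  also have "\<dots> = (\<Sum>j\<in>UNIV. \<Sum>i\<in>UNIV. of_real (A $ i $ j) * cnj (x $ j) * y $ i)"
    by (rule sum.swap)
  also have "\<dots> = cinner x (cmat (transpose A) *v y)"
    by (simp add: cinner_def matrix_vector_mult_def cmat_def transpose_def sum_distrib_left mult_ac)
  finally show ?thesis .
qed

text \<open>For uniqueness, the difference of two candidate values lies in the subspace and is
  orthogonal to itself.\<close>

lemma orth_proj_symmetric_idempotent: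
  fixes E :: "real^'n^'n"
  assumes E: "E ** E = E" "transpose E = E"
  shows "orth_proj {x. cmat E *v x = x} = cmat E"
  unfolding orth_proj_def
proof (rule the_equality)
  have EE: "cmat E *v (cmat E *v x) = cmat E *v x" for x
    by (metis E(1) cmat_mult matrix_vector_mul_assoc)
  have "cinner y (x - cmat E *v x) = 0" if "cmat E *v y = y" for x y
    using cinner_transpose[of E y "x - cmat E *v x"] that by (simp add: E matvec EE)
  then show *: "\<forall>x. cmat E *v x \<in> {x. cmat E *v x = x} \<and> (\<forall>y\<in>{x. cmat E *v x = x}. cinner y (x - cmat E *v x) = 0)"
    by (simp add: EE)
  fix P :: "complex^'n^'n"
  assume P: "\<forall>x. P *v x \<in> {x. cmat E *v x = x} \<and> (\<forall>y\<in>{x. cmat E *v x = x}. cinner y (x - P *v x) = 0)"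
  show "P = cmat E"
  proof (rule matrix_eqI)
    fix x
    let ?z = "P *v x - cmat E *v x"
    have "cmat E *v ?z = ?z" using P by (simp add: matvec EE)
    then have "cinner ?z (x - P *v x) = 0" "cinner ?z (x - cmat E *v x) = 0" using P * by auto
    then have "cinner ?z ?z = 0" by (simp add: cinner_arith)
    then show "P *v x = cmat E *v x" by simp
  qed
qed

text \<open>\<open>E\<close> is the projection onto the zero eigenspace in an orthonormal eigenbasis
  of \<open>A\<close>. It is real and still serves the complex kernel. The clause on
  \<open>X\<close> concerns matrices whose columns lie in the kernel and is meant for products of
  matrices.\<close>

theorem ex_kernel_projection:
  fixes A :: "real^'n^'n"
  assumes A: "transpose A = A"
  obtains E where "E ** E = E" "transpose E = E" "A ** E = 0" "\<And>X. A ** X = 0 \<Longrightarrow> E ** X = (X :: real^'n^'n)"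
    "ker (cmat A) = {x. cmat E *v x = x}" "orth_proj (ker (cmat A)) = cmat E"
    "\<And>x. det (mat x ** cmat E + (mat 1 - cmat E)) = x ^ (CARD('n) - rank A)"
    "vec.dim (ker (cmat A)) = CARD('n) - rank A"
proof -
  obtain U :: "real^'n^'n" and d where U: "U ** transpose U = mat 1" "transpose U ** U = mat 1"
    "A = U ** diag_mat d ** transpose U"
    by (rule spectral_theorem[OF A(1)])
  define Z where "Z = {i. d i = 0}"
  define E where "E = U ** coord_proj Z ** transpose U"
  \<comment> \<open>The pseudoinverse of \<open>A\<close>: since \<open>inverse 0 = 0\<close>, both
    \<open>A ** Y\<close> and \<open>Y ** A\<close> equal \<open>mat 1 - E\<close>.\<close>
  define Y where "Y = U ** diag_mat (\<lambda>i. inverse (d i)) ** transpose U"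
  have cp: "coord_proj I = (diag_mat (\<lambda>i. if i \<in> I then 1 else 0) :: real^'n^'n)" for I
    by (auto simp: coord_proj_def diag_mat_def vec_eq_iff)
  have tE: "transpose E = E" by (simp add: E_def matrix_transpose_mul matrix_mul_assoc)
  note cE = conj_coord_proj[OF U(1,2) E_def]
  have dz: "(\<lambda>i. d i * (if i \<in> Z then 1 else 0)) = (\<lambda>i. 0)" by (auto simp: Z_def)
  have AE: "A ** E = 0"
    unfolding U(3) E_def cp conj_diag_mult[OF U(2)] dz
    by (simp add: diag_mat_zero)
  have EA: "E ** A = 0"
    by (metis A AE mat_0 matrix_transpose_mul tE transpose_mat)
  have di: "(\<lambda>i. d i * inverse (d i)) = (\<lambda>i. if i \<in> - Z then 1 else 0)" by (auto simp: Z_def)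
  have di': "(\<lambda>i. inverse (d i) * d i) = (\<lambda>i. if i \<in> - Z then 1 else 0)" by (auto simp: Z_def)
  have AY: "A ** Y = mat 1 - E"
    unfolding cE(4) unfolding U(3) Y_def cp conj_diag_mult[OF U(2)] di ..
  have YA: "Y ** A = mat 1 - E"
    unfolding cE(4) unfolding U(3) Y_def cp conj_diag_mult[OF U(2)] di' ..
  have "range ((*v) A) = range ((*v) (mat 1 - E))"
  proof
    have "A *v x = (mat 1 - E) *v (A *v x)" for x
      by (simp add: matvec) (simp add: matrix_vector_mul_assoc EA)
    then show "range ((*v) A) \<subseteq> range ((*v) (mat 1 - E))" by blast
    show "range ((*v) (mat 1 - E)) \<subseteq> range ((*v) A)"
      by (auto simp: AY[symmetric] simp flip: matrix_vector_mul_assoc)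
  qed
  then have "rank A = card (- Z)"
    using conj_coord_proj_dim[OF U(1,2) cE(4)] by (simp add: rank_dim_range dim_vec_eq)
  then have Z: "card Z = CARD('n) - rank A"
    by (simp add: Compl_eq_Diff_UNIV card_Diff_subset card_mono)
  have "E ** X = X" if "A ** X = 0" for X :: "real^'n^'n"
  proof -
    have "X - E ** X = (Y ** A) ** X" by (rule matrix_eqI) (simp add: YA matvec)
    also have "\<dots> = 0" by (simp add: that flip: matrix_mul_assoc)
    finally show ?thesis by simp
  qed
  moreover have cU: "cmat U ** cmat (transpose U) = mat 1" "cmat (transpose U) ** cmat U = mat 1"
    by (metis U(1,2) cmat_arith(5) cmat_mult of_real_1)+
  have cE': "cmat E = cmat U ** coord_proj Z ** cmat (transpose U)"
    by (simp add: E_def cmat_mult)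
  note ccE = conj_coord_proj[OF cU cE']
  have EE: "cmat E *v (cmat E *v x) = cmat E *v x" for x by (metis ccE(1) matrix_vector_mul_assoc)
  have ker: "ker (cmat A) = {x. cmat E *v x = x}"
  proof (intro equalityI subsetI)
    fix x assume "x \<in> ker (cmat A)"
    then have "cmat (Y ** A) *v x = 0" by (simp add: ker_def cmat_mult flip: matrix_vector_mul_assoc)
    then show "x \<in> {x. cmat E *v x = x}" by (simp add: YA matvec)
  next
    fix x assume "x \<in> {x. cmat E *v x = x}"
    moreover have "cmat A *v (cmat E *v x) = 0"
      by (simp add: matrix_vector_mul_assoc AE flip: cmat_mult)
    ultimately show "x \<in> ker (cmat A)" by (simp add: ker_def)
  qed
  have "{x. cmat E *v x = x} = range ((*v) (cmat E))" using EE by auto (metis rangeI)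
  then have dim: "vec.dim (ker (cmat A)) = CARD('n) - rank A" by (simp add: ker ccE(3) Z)
  moreover have "orth_proj (ker (cmat A)) = cmat E"
    unfolding ker by (rule orth_proj_symmetric_idempotent[OF cE(1) tE])
  ultimately show ?thesis
    using that[OF cE(1) tE AE _ ker _ _ dim] ccE(2) Z by simp
qed

text \<open>The projection is kept as a real matrix, so that its adjoint is its transpose;
  injectivity of \<open>cmat\<close> makes the choice unique.\<close>

definition ker_proj :: "real^'n^'n \<Rightarrow> real^'n^'n" where
  "ker_proj A = (SOME E. orth_proj (ker (cmat A)) = cmat E)"

lemma ker_proj:
  fixes A :: "real^'n^'n"
  assumes "transpose A = A"
  defines "E \<equiv> ker_proj A"
  shows ker_proj_idem: "E ** E = E" and transpose_ker_proj: "transpose E = E"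
    and mult_ker_proj: "A ** E = 0" and ker_proj_mult: "\<And>X. A ** X = 0 \<Longrightarrow> E ** X = (X :: real^'n^'n)"
    and ker_eq_ker_proj: "ker (cmat A) = {x. cmat E *v x = x}"
    and orth_proj_ker: "orth_proj (ker (cmat A)) = cmat E"
    and det_ker_proj: "\<And>x. det (mat x ** cmat E + (mat 1 - cmat E)) = x ^ (CARD('n) - rank A)"
    and dim_ker: "vec.dim (ker (cmat A)) = CARD('n) - rank A"
proof -
  obtain F where F: "F ** F = F" "transpose F = F" "A ** F = 0" "\<And>X. A ** X = 0 \<Longrightarrow> F ** X = (X :: real^'n^'n)"
    "ker (cmat A) = {x. cmat F *v x = x}" "orth_proj (ker (cmat A)) = cmat F"
    "\<And>x. det (mat x ** cmat F + (mat 1 - cmat F)) = x ^ (CARD('n) - rank A)"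
    "vec.dim (ker (cmat A)) = CARD('n) - rank A"
    by (rule ex_kernel_projection[OF assms(1)]) blast
  have "E = F" unfolding E_def ker_proj_def F(6) by (rule some_equality) auto
  then show "E ** E = E" "transpose E = E" "A ** E = 0" "\<And>X. A ** X = 0 \<Longrightarrow> E ** X = (X :: real^'n^'n)"
    "ker (cmat A) = {x. cmat E *v x = x}" "orth_proj (ker (cmat A)) = cmat E"
    "\<And>x. det (mat x ** cmat E + (mat 1 - cmat E)) = x ^ (CARD('n) - rank A)"
    "vec.dim (ker (cmat A)) = CARD('n) - rank A"
    using F by simp_all
qed

section \<open>Block matrices and compressions\<close>

definition join_vec :: "'a^'n \<Rightarrow> 'a^'m \<Rightarrow> 'a^('n + 'm)" where
  "join_vec x y = (\<chi> i. case i of Inl k \<Rightarrow> x $ k | Inr k \<Rightarrow> y $ k)"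

lemma join_vec_cases:
  obtains x y where "v = join_vec x y"
proof
  show "v = join_vec (\<chi> k. v $ Inl k) (\<chi> k. v $ Inr k)"
    by (simp add: join_vec_def vec_eq_iff split: sum.split)
qed

lemma join_vec_eq_iff [simp]: "join_vec x y = join_vec x' y' \<longleftrightarrow> x = x' \<and> y = y'"
  by (simp add: join_vec_def vec_eq_iff split_sum_all split: sum.split)

lemma join_vec_arith: "join_vec x y + join_vec x' y' = join_vec (x + x') (y + y')"
  "join_vec x y - join_vec x' y' = join_vec (x - x') (y - y')"
  "c *s join_vec x y = join_vec (c *s x) (c *s y)"
  "- join_vec x y = join_vec (- x) (- y)"
  by (simp_all add: join_vec_def vec_eq_iff split: sum.split)

lemma join_vec_zero: "0 = join_vec x y \<longleftrightarrow> x = 0 \<and> y = 0" "join_vec x y = 0 \<longleftrightarrow> x = 0 \<and> y = 0"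
proof -
  have "0 = join_vec 0 (0 :: 'a^'c)" by (simp add: join_vec_def vec_eq_iff split: sum.split)
  then show "0 = join_vec x y \<longleftrightarrow> x = 0 \<and> y = 0" "join_vec x y = 0 \<longleftrightarrow> x = 0 \<and> y = 0"
    by (metis join_vec_eq_iff)+
qed

lemma sum_UNIV_sum: "(\<Sum>i\<in>UNIV. f i) = (\<Sum>k\<in>UNIV. f (Inl k)) + (\<Sum>k\<in>UNIV. f (Inr k))"
  for f :: "'n::finite + 'm::finite \<Rightarrow> 'a::comm_monoid_add"
  by (simp add: UNIV_Plus_UNIV[symmetric] sum.Plus del: UNIV_Plus_UNIV)

lemma block_mat_vec:
  "block_mat A B C D *v join_vec x y = join_vec (A *v x + B *v y) (C *v x + D *v y)"
  by (simp add: vec_eq_iff matrix_vector_mult_def sum_UNIV_sum block_mat_def join_vec_def split: sum.split)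

lemma block_mat_eqI:
  fixes A :: "'a::field^('n::finite + 'm::finite)^'k"
  assumes "\<And>x y. A *v join_vec x y = B *v join_vec x y"
  shows "A = B"
  by (rule matrix_eqI) (metis assms join_vec_cases)

lemma block_mat_zero: "block_mat 0 0 0 0 = 0"
  by (auto simp: block_mat_def vec_eq_iff split: sum.splits)

lemma transpose_block_mat:
  "transpose (block_mat A B C D) = block_mat (transpose A) (transpose C) (transpose B) (transpose D)"
  by (auto simp: block_mat_def vec_eq_iff transpose_def split: sum.splits)

lemma cmat_block_mat: "cmat (block_mat A B C D) = block_mat (cmat A) (cmat B) (cmat C) (cmat D)"
  by (auto simp: block_mat_def vec_eq_iff cmat_def split: sum.splits)

lemma block_mat_mult:
  fixes A A' :: "'a::field^'n^'n"
  shows "block_mat A B C D ** block_mat A' B' C' D' =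
    block_mat (A ** A' + B ** C') (A ** B' + B ** D') (C ** A' + D ** C') (C ** B' + D ** D')"
  by (rule block_mat_eqI) (simp add: matvec block_mat_vec join_vec_arith add_ac)

text \<open>An injective linear map carries eigenspaces and generalized eigenspaces along without
  changing dimensions. This identifies a summand of the doubled space with the original
  space.\<close>

lemma det_on_range:
  fixes f :: "complex^'n \<Rightarrow> complex^'k"
  assumes f: "Vector_Spaces.linear (*s) (*s) f" "inj f" and T: "\<And>v. T' (f v) = f (T v)"
  shows "det_on (range f) T' = det_on UNIV T"
proof -
  interpret f: Vector_Spaces.linear "(*s)" "(*s)" f by (rule f(1))
  have zero: "f v = 0 \<longleftrightarrow> v = 0" for v by (metis f(2) f.zero injD)
  have sp: "spectrum_on (range f) T' = spectrum_on UNIV T"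
  proof -
    have "T' (f v) = \<mu> *s f v \<longleftrightarrow> T v = \<mu> *s v" for v \<mu>
      by (metis T f(2) f.scale injD)
    then show ?thesis by (auto simp: spectrum_on_def zero)
  qed
  have "eig_mult (range f) T' \<mu> = eig_mult UNIV T \<mu>" for \<mu>
  proof -
    have iter: "((\<lambda>w. T' w - \<mu> *s w) ^^ k) (f v) = f (((\<lambda>w. T w - \<mu> *s w) ^^ k) v)" for k v
      by (induction k) (simp_all add: T f.diff f.scale)
    have "{v \<in> range f. \<exists>k. ((\<lambda>w. T' w - \<mu> *s w) ^^ k) v = 0} =
        f ` {v \<in> UNIV. \<exists>k. ((\<lambda>w. T w - \<mu> *s w) ^^ k) v = 0}"
      by (auto simp: iter zero intro!: imageI)
    then show ?thesis
      unfolding eig_mult_def by (simp only: vec.dim_image_eq[OF f(1) inj_on_subset[OF f(2) subset_UNIV]])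
  qed
  then show ?thesis by (simp add: det_on_def sp)
qed

text \<open>The block matrix is the identity modulo the first summand, so
  \<open>det_on_eq_det\<close> restricts it to that summand and \<open>det_on_range\<close> removes
  the embedding.\<close>

lemma det_block_mat_Inl: "det (block_mat A 0 0 (mat 1) :: complex^('n::finite + 'n)^('n + 'n)) = det A"
proof -
  let ?E = "block_mat (mat 1) 0 0 0 :: complex^('n + 'n)^('n + 'n)"
  let ?N = "block_mat A 0 0 (mat 1) :: complex^('n + 'n)^('n + 'n)"
  have "{v. ?E *v v = v} = range (\<lambda>x. join_vec x 0)"
  proof (rule set_eqI)
    fix v show "v \<in> {v. ?E *v v = v} \<longleftrightarrow> v \<in> range (\<lambda>x. join_vec x 0)"
      by (cases v rule: join_vec_cases) (auto simp: block_mat_vec)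
  qed
  moreover have "det_on {v. ?E *v v = v} ((*v) ?N) = det ?N"
  proof (rule det_on_eq_det)
    fix v assume "?E *v v = v"
    then show "?E *v (?N *v v) = ?N *v v"
      by (cases v rule: join_vec_cases) (auto simp: block_mat_vec)
  next
    fix v show "?N *v v - ?E *v (?N *v v) = v - ?E *v v"
      by (cases v rule: join_vec_cases) (auto simp: block_mat_vec join_vec_arith)
  qed simp
  moreover have "det_on (range (\<lambda>x. join_vec x 0 :: complex^('n + 'n))) ((*v) ?N) = det_on UNIV ((*v) A)"
  proof (rule det_on_range)
    show "Vector_Spaces.linear (*s) (*s) (\<lambda>x. join_vec x 0 :: complex^('n + 'n))"
      by unfold_locales (simp_all add: join_vec_arith vec.scale_right_distrib vec.scale_left_distrib)
  qed (auto simp: inj_def block_mat_vec)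
  ultimately show ?thesis by (simp add: det_eq_det_on)
qed

lemma det_block_mat_Inr: "det (block_mat (mat 1) 0 0 A :: complex^('n::finite + 'n)^('n + 'n)) = det A"
proof -
  let ?S = "block_mat 0 (mat 1) (mat 1) 0 :: complex^('n + 'n)^('n + 'n)"
  have "?S ** block_mat A 0 0 (mat 1) ** ?S = block_mat (mat 1) 0 0 A"
    by (simp add: block_mat_mult)
  moreover have "det ?S * det ?S = 1"
  proof -
    have "?S ** ?S = mat 1" by (rule block_mat_eqI) (simp add: matvec block_mat_vec)
    then show ?thesis by (metis det_I det_mul)
  qed
  ultimately have "det (block_mat (mat 1) 0 0 A :: complex^('n + 'n)^('n + 'n)) =
      (det ?S * det ?S) * det (block_mat A 0 0 (mat 1) :: complex^('n + 'n)^('n + 'n))"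
    by (metis (no_types, lifting) det_mul mult.assoc mult.commute)
  then show ?thesis using \<open>det ?S * det ?S = 1\<close> by (simp add: det_block_mat_Inl)
qed

text \<open>Block elimination with the scalar lower right block as pivot; \<open>?U\<close> and
  \<open>?L\<close> have square zero.\<close>

lemma det_schur:
  fixes A B C :: "complex^'n^'n"
  assumes "x \<noteq> 0"
  shows "det (block_mat A B C (mat x)) = x ^ CARD('n) * det (A - mat (1 / x) ** (B ** C))"
proof -
  let ?U = "block_mat 0 (mat (1 / x) ** B) 0 0 :: complex^('n + 'n)^('n + 'n)"
  let ?L = "block_mat 0 0 (mat (1 / x) ** C) 0 :: complex^('n + 'n)^('n + 'n)"
  let ?S = "A - mat (1 / x) ** (B ** C)"
  have "block_mat A B C (mat x) = (mat 1 + ?U) ** block_mat ?S 0 0 (mat 1) **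
      block_mat (mat 1) 0 0 (mat x) ** (mat 1 + ?L)"
    using assms by (intro block_mat_eqI)
      (simp add: matvec block_mat_vec join_vec_arith vec.scale_right_distrib)
  moreover have "det (mat 1 + ?U) = 1" "det (mat 1 + ?L) = 1"
    by (rule det_one_plus_square_zero, simp add: block_mat_mult block_mat_zero)+
  ultimately show ?thesis
    by (simp add: det_mul det_block_mat_Inl det_block_mat_Inr det_mat)
qed

lemma ex_poly_det_quadratic:
  fixes A B C :: "'a::comm_ring_1^'n^'n"
  obtains p where "\<And>x. poly p x = det (A + mat x ** B + mat (x\<^sup>2) ** C)"
proof
  fix x
  have "A + mat x ** B + mat (x\<^sup>2) ** C =
      map_matrix (\<lambda>p. poly p x) (\<chi> i j. [:A $ i $ j, B $ i $ j, C $ i $ j:])"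
    by (simp add: vec_eq_iff mat_mult_component power2_eq_square algebra_simps)
  then show "poly (det (\<chi> i j. [:A $ i $ j, B $ i $ j, C $ i $ j:])) x = det (A + mat x ** B + mat (x\<^sup>2) ** C)"
    by (simp add: poly_det)
qed

text \<open>\<open>D\<close> is the characteristic polynomial of \<open>M\<close> on the range of
  \<open>E\<close>; the last clause accounts for the zero eigenvalue that \<open>M\<close> acquires
  on the kernel of \<open>E\<close>.\<close>

lemma eig_mult_compression:
  fixes E M :: "complex^'n^'n"
  assumes E: "E ** E = E" "E ** M = M" "M ** E = M"
    and D: "\<And>x. poly D x = det (mat x ** E - M + (mat 1 - E))"
  shows spectrum_compression: "spectrum_on {v. E *v v = v} ((*v) M) = {\<mu>. poly D \<mu> = 0}"
    and order_compression: "eig_mult {v. E *v v = v} ((*v) M) \<mu> = order \<mu> D"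
    and charpoly_compression: "poly (charpoly M) x = det (mat x ** (mat 1 - E) + E) * poly D x"
proof -
  have e: "E *v (E *v v) = E *v v" "E *v (M *v v) = M *v v" "M *v (E *v v) = M *v v" for v
    by (simp_all add: matrix_vector_mul_assoc E)
  have "\<mu> \<in> spectrum_on {v. E *v v = v} ((*v) M) \<longleftrightarrow> poly D \<mu> = 0"
    and "eig_mult {v. E *v v = v} ((*v) M) \<mu> = order \<mu> D" for \<mu>
  proof -
    \<comment> \<open>\<open>M\<close> acts as \<open>0\<close> on the kernel of \<open>E\<close>; shifting that eigenvalue away from \<open>\<mu>\<close> makes the
      generalized eigenspace of \<open>\<mu>\<close> lie in the range of \<open>E\<close>, also for \<open>\<mu> = 0\<close>.\<close>
    define c where "c = \<mu> + 1"
    define N where "N = M + mat c ** (mat 1 - E)"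
    have tr: "\<mu> \<in> spectrum_on UNIV ((*v) N) \<longleftrightarrow> \<mu> \<in> spectrum_on {v. E *v v = v} ((*v) M)"
      "eig_mult UNIV ((*v) N) \<mu> = eig_mult {v. E *v v = v} ((*v) M) \<mu>"
      by (rule eig_transfer[where c = c], auto simp: N_def c_def matvec e)+
    obtain f where f: "\<And>x. poly f x = det (mat x ** (mat 1 - E) + (E - mat c ** (mat 1 - E)))"
      by (rule ex_poly_det_affine) blast
    have "poly (charpoly N) x = poly (f * D) x" for x
    proof -
      have "mat x - N = (mat x ** (mat 1 - E) + (E - mat c ** (mat 1 - E))) ** (mat x ** E - M + (mat 1 - E))"
        by (rule matrix_eqI) (simp add: N_def matvec e)
      then show ?thesis by (simp add: poly_charpoly det_mul f D)
    qed
    then have N: "charpoly N = f * D" by (metis poly_eq_poly_eq_iff ext)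
    have f0: "poly f \<mu> \<noteq> 0"
      unfolding f det_nz_iff_ker
    proof (intro allI impI)
      fix v assume "(mat \<mu> ** (mat 1 - E) + (E - mat c ** (mat 1 - E))) *v v = 0"
      \<comment> \<open>Since \<open>c = \<mu> + 1\<close>, the matrix is \<open>2 E - 1\<close>, an
        involution.\<close>
      from arg_cong[OF this, of "\<lambda>u. u $ i" for i]
      have "2 * (E *v v) $ i = v $ i" for i by (simp add: matvec c_def algebra_simps)
      then have *: "2 *s (E *v v) = v" by (simp add: vec_eq_iff)
      then have "2 *s (E *v v) = E *v v" by (metis e(1) vec.scale)
      then have "E *v v = 0" by (simp add: vec_eq_iff)
      then show "v = 0" using * by simp
    qed
    show "\<mu> \<in> spectrum_on {v. E *v v = v} ((*v) M) \<longleftrightarrow> poly D \<mu> = 0"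
      using tr(1) f0 by (simp add: spectrum_charpoly N)
    have "order \<mu> (charpoly N) = order \<mu> f + order \<mu> D"
      unfolding N by (rule order_mult) (metis N charpoly_nonzero)
    then show "eig_mult {v. E *v v = v} ((*v) M) \<mu> = order \<mu> D"
      using tr(2) f0 by (simp add: order_charpoly order_0I)
  qed
  then show "spectrum_on {v. E *v v = v} ((*v) M) = {\<mu>. poly D \<mu> = 0}"
    "eig_mult {v. E *v v = v} ((*v) M) \<mu> = order \<mu> D" by auto
  have "mat x - M = (mat x ** (mat 1 - E) + E) ** (mat x ** E - M + (mat 1 - E))"
    by (rule matrix_eqI) (simp add: matvec e)
  then show "poly (charpoly M) x = det (mat x ** (mat 1 - E) + E) * poly D x"
    by (simp add: poly_charpoly det_mul D)
qed

section \<open>The compressed system operator\<close>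

lemma transpose_arith: "transpose (A + B) = transpose A + transpose B"
  "transpose (A - B) = transpose A - transpose B" "transpose (- A) = - transpose A"
  "transpose 0 = 0"
  by (simp_all add: vec_eq_iff transpose_def)

lemma cmat_vec_assoc: "cmat A *v (cmat B *v x) = cmat (A ** B) *v x"
  by (simp add: cmat_mult matrix_vector_mul_assoc)

lemma pencil_vec:
  "pencil \<alpha> \<eta> \<theta> R \<zeta> 0 *v x = \<zeta>\<^sup>2 *s (cmat \<alpha> *v x) + (2 * \<i> * \<zeta>) *s (cmat \<theta> *v x) - cmat \<eta> *v x"
  by (simp add: pencil_def matvec mult_ac)

lemma pos_def_ker:
  fixes A :: "real^'n^'n"
  assumes "pos_def A"
  shows pos_def_invertible: "invertible A" and ker_cmat_pos_def: "ker (cmat A) = {0}"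
proof -
  have "A *v x \<noteq> 0" if "x \<noteq> 0" for x
    using assms that by (metis inner_zero_right less_irrefl pos_def_def)
  then show inv: "invertible A"
    by (metis invertible_left_inverse matrix_left_invertible_ker)
  then obtain B where "B ** A = mat 1" by (auto simp: invertible_def)
  then have "cmat B *v (cmat A *v x) = x" for x by (simp add: cmat_vec_assoc)
  then show "ker (cmat A) = {0}" by (auto simp: ker_def) (metis matrix_vector_mult_0_right)
qed

lemma rank_conj_invertible:
  fixes R b :: "real^'n^'n"
  assumes "a ** b = mat 1" "b ** a = mat 1"
  shows "rank (b ** R ** b) = rank R"
proof (rule antisym)
  show "rank (b ** R ** b) \<le> rank R"
    by (meson order.trans rank_mul_le_left rank_mul_le_right)
  have "a ** (b ** R ** b) ** a = (a ** b) ** R ** (b ** a)" by (simp add: matrix_mul_assoc)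
  then have "R = a ** (b ** R ** b) ** a" by (simp add: assms)
  then show "rank R \<le> rank (b ** R ** b)"
    by (metis order.trans rank_mul_le_left rank_mul_le_right)
qed

text \<open>The identity on the orthogonal complement of \<open>ker R\<close> turns the compression
  into a full-size matrix, so that determinants multiply.\<close>

definition ker_det :: "real^'n^'n \<Rightarrow> complex^'n^'n \<Rightarrow> complex" where
  "ker_det R X = det (mat 1 - P_R R + P_R R ** X ** P_R R)"

lemma det_on_ker:
  assumes "transpose R = R"
  shows "det_on (ker (cmat R)) ((*v) (P_R R ** X ** P_R R)) = ker_det R X"
proof -
  note R = ker_proj[OF assms]
  have q: "cmat (ker_proj R) *v (cmat (ker_proj R) *v v) = cmat (ker_proj R) *v v" for v
    by (simp add: cmat_vec_assoc R(1))
  have "P_R R = cmat (ker_proj R)" by (simp add: P_R_def R(6))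
  then show ?thesis
    unfolding ker_det_def R(5) by (intro det_on_eq_det) (simp_all add: matvec q)
qed

text \<open>Definiteness is asked of \<open>\<alpha>\<close> only; interchanging
  \<open>\<alpha>\<close> and \<open>\<eta>\<close> gives a second instance as soon as
  \<open>\<eta>\<close> is definite too.\<close>

locale damped_system =
  fixes \<alpha> \<eta> \<theta> R :: "real^'n^'n"
  assumes alpha: "transpose \<alpha> = \<alpha>" "pos_def \<alpha>"
    and eta: "transpose \<eta> = \<eta>" "pos_semidef \<eta>"
    and theta: "transpose \<theta> = - \<theta>"
    and R: "transpose R = R"
    and rank_pos: "rank R > 0"
begin

definition a where "a = psd_sqrt \<alpha>"
definition b where "b = matrix_inv a"
definition e where "e = psd_sqrt \<eta>"
definition q where "q = ker_proj R"
definition k where "k = ker_proj (b ** R ** b)"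

lemma alpha_psd: "pos_semidef \<alpha>"
  using alpha(2) unfolding pos_def_def pos_semidef_def
  by (metis inner_zero_left less_eq_real_def)

lemma aa: "a ** a = \<alpha>" and ta: "transpose a = a"
  using psd_sqrt[OF alpha(1) alpha_psd] by (simp_all add: a_def)

lemma ee: "e ** e = \<eta>" and te: "transpose e = e"
  using psd_sqrt[OF eta] by (simp_all add: e_def)

lemma ab: "a ** b = mat 1" and ba: "b ** a = mat 1"
proof -
  obtain B where "B ** (a ** a) = mat 1"
    using pos_def_invertible[OF alpha(2)] by (auto simp: invertible_def aa)
  then have "(B ** a) ** a = mat 1" by (simp add: matrix_mul_assoc)
  then have "invertible a" using invertible_left_inverse by blast
  then have "\<exists>B. a ** B = mat 1 \<and> B ** a = mat 1" by (simp add: invertible_def)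
  then have "a ** b = mat 1 \<and> b ** a = mat 1"
    unfolding b_def matrix_inv_def by (rule someI_ex)
  then show "a ** b = mat 1" "b ** a = mat 1" by auto
qed

lemma tb: "transpose b = b"
proof -
  have "transpose b ** a = mat 1" by (metis ab matrix_transpose_mul ta transpose_mat)
  then show ?thesis by (metis ab matrix_mul_assoc matrix_mul_lid matrix_mul_rid)
qed

lemma bRb: "transpose (b ** R ** b) = b ** R ** b"
  by (simp add: matrix_transpose_mul tb R matrix_mul_assoc)

lemma rank_bRb: "rank (b ** R ** b) = rank R"
  by (rule rank_conj_invertible[OF ab ba])

lemmas q_props = ker_proj[OF R, folded q_def]
lemmas k_props = ker_proj[OF bRb, folded k_def, unfolded rank_bRb]

text \<open>\<open>a\<close> maps \<open>ker R\<close> into \<open>ker (b R b)\<close> because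
  \<open>b\<close> cancels it; \<open>qbk\<close> is the way back.\<close>

lemma kaq: "k ** (a ** q) = a ** q"
proof (rule k_props(4))
  have "(b ** R ** b) ** (a ** q) = (b ** R) ** (b ** a) ** q" by (simp add: matrix_mul_assoc)
  also have "\<dots> = b ** (R ** q)" by (simp add: ba matrix_mul_assoc)
  finally show "(b ** R ** b) ** (a ** q) = 0" by (simp add: q_props)
qed

lemma qbk: "q ** (b ** k) = b ** k"
proof (rule q_props(4))
  have "R ** (b ** k) = (a ** b) ** R ** b ** k" by (simp add: ab matrix_mul_assoc)
  also have "\<dots> = a ** ((b ** R ** b) ** k)" by (simp add: matrix_mul_assoc)
  finally show "R ** (b ** k) = 0" by (simp add: k_props)
qed

text \<open>The adjoint of \<open>kaq\<close>: \<open>a\<close> maps the orthogonal complement of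
  the range of \<open>k\<close> into that of the range of \<open>q\<close>. In the same way
  \<open>kbq\<close> is the adjoint of \<open>qbk\<close>.\<close>

lemma qak: "q ** a ** k = q ** a"
  using arg_cong[OF kaq, of transpose] by (simp add: matrix_transpose_mul q_props k_props ta matrix_mul_assoc)

lemma kbq: "k ** b ** q = k ** b"
  using arg_cong[OF qbk, of transpose] by (simp add: matrix_transpose_mul q_props k_props tb matrix_mul_assoc)

text \<open>As rewrite rules on vectors these decide the later identities between products of
  non-commuting matrices, once both sides are applied to a vector.\<close>

lemma vec_simps:
  "cmat a *v (cmat b *v x) = x" "cmat b *v (cmat a *v x) = x"
  "cmat q *v (cmat q *v x) = cmat q *v x" "cmat k *v (cmat k *v x) = cmat k *v x"
  "cmat k *v (cmat a *v (cmat q *v x)) = cmat a *v (cmat q *v x)"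
  "cmat q *v (cmat b *v (cmat k *v x)) = cmat b *v (cmat k *v x)"
  "cmat q *v (cmat a *v (cmat k *v x)) = cmat q *v (cmat a *v x)"
  "cmat k *v (cmat b *v (cmat q *v x)) = cmat k *v (cmat b *v x)"
  by (simp_all add: cmat_vec_assoc ab ba kaq qbk qak kbq q_props k_props matrix_mul_assoc)
    (metis kaq qbk matrix_mul_assoc)+

lemma alpha_vec: "cmat \<alpha> *v x = cmat a *v (cmat a *v x)"
  by (simp add: cmat_vec_assoc aa)

lemma eta_vec: "cmat \<eta> *v x = cmat e *v (cmat e *v x)"
  by (simp add: cmat_vec_assoc ee)

lemma P_R: "P_R R = cmat q"
  by (simp only: P_R_def q_props(6))

definition scaled_det :: "complex^'n^'n \<Rightarrow> complex" where
  "scaled_det X = det (mat 1 - cmat k + cmat k ** cmat b ** X ** cmat b ** cmat k)"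

text \<open>The congruence by \<open>l\<close> yields the compression of \<open>X\<close> to
  \<open>ker R\<close> together with a block on the complement that does not involve
  \<open>X\<close>. Its determinant \<open>d\<close> and that of \<open>l\<close> are eliminated by
  \<open>X = \<alpha>\<close>, where \<open>b \<alpha> b = 1\<close>.\<close>

lemma ker_det_alpha: "ker_det R (cmat \<alpha>) \<noteq> 0"
  and scaled_det_eq: "scaled_det X * ker_det R (cmat \<alpha>) = ker_det R X"
proof -
  define l where "l = a ** q + b ** (mat 1 - q)"
  define d where "d = det (cmat q + (mat 1 - cmat q) ** cmat b ** cmat b ** (mat 1 - cmat q))"
  have tl: "transpose l = q ** a + (mat 1 - q) ** b"
    by (simp add: l_def transpose_arith matrix_transpose_mul ta tb q_props)
  have l_vec: "cmat l *v x = cmat a *v (cmat q *v x) + cmat b *v (x - cmat q *v x)" for x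
    by (simp add: l_def cmat_mult matvec)
  have lt_vec: "cmat (transpose l) *v x = cmat q *v (cmat a *v x) + (cmat b *v x - cmat q *v (cmat b *v x))" for x
    by (simp add: tl cmat_mult matvec del: cmat_arith(6))
  \<comment> \<open>The second summand of \<open>l\<close> drops out because
    \<open>k b (1 - q) = 0\<close>.\<close>
  have kl: "cmat k *v (cmat l *v x) = cmat a *v (cmat q *v x)" for x
    by (simp add: l_vec matvec vec_simps)
  have key: "(det (cmat l))\<^sup>2 * scaled_det X = ker_det R X * d" for X
  proof -
    have "cmat (transpose l) ** (mat 1 - cmat k + cmat k ** cmat b ** X ** cmat b ** cmat k) ** cmat l =
        (mat 1 - P_R R + P_R R ** X ** P_R R) ** (cmat q + (mat 1 - cmat q) ** cmat b ** cmat b ** (mat 1 - cmat q))"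
      by (rule matrix_eqI) (simp add: P_R matvec kl vec_simps lt_vec l_vec del: cmat_arith(6))
    from arg_cong[OF this, of det] show ?thesis
      by (simp add: det_mul scaled_det_def ker_det_def d_def power2_eq_square mult_ac)
  qed
  have "scaled_det (cmat \<alpha>) = 1"
  proof -
    have "mat 1 - cmat k + cmat k ** cmat b ** cmat \<alpha> ** cmat b ** cmat k = mat 1"
      by (rule matrix_eqI) (simp add: matvec alpha_vec vec_simps)
    then show ?thesis by (simp add: scaled_det_def)
  qed
  then have l2: "(det (cmat l))\<^sup>2 = ker_det R (cmat \<alpha>) * d" using key[of "cmat \<alpha>"] by simp
  have "det (cmat l) \<noteq> 0"
    unfolding det_nz_iff_ker
  proof (intro allI impI)
    fix v assume v: "cmat l *v v = 0"
    then have "cmat b *v (cmat a *v (cmat q *v v)) = 0" using kl[of v] by simp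
    then have "cmat q *v v = 0" by (simp add: vec_simps)
    then have "cmat a *v (cmat b *v v) = 0" using v by (simp add: l_vec)
    then show "v = 0" by (simp add: vec_simps)
  qed
  then have nz: "ker_det R (cmat \<alpha>) * d \<noteq> 0" using l2 by (metis power_not_zero)
  then show "ker_det R (cmat \<alpha>) \<noteq> 0" by simp
  have "d * (scaled_det X * ker_det R (cmat \<alpha>)) = d * ker_det R X"
    using key[of X] by (simp add: l2 mult_ac)
  then show "scaled_det X * ker_det R (cmat \<alpha>) = ker_det R X" using nz by simp
qed

definition pb :: "real^('n + 'n)^('n + 'n)" where "pb = block_mat k 0 0 (mat 1)"
abbreviation M where "M \<equiv> compressed_Omega \<alpha> \<eta> \<theta> R"

lemma pb_vec: "cmat pb *v join_vec x y = join_vec (cmat k *v x) y"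
  by (simp add: pb_def cmat_block_mat block_mat_vec)

lemma ker_B: "ker (B_mat \<alpha> R) = {v. cmat pb *v v = v}"
proof (rule set_eqI)
  fix v :: "complex^('n + 'n)"
  obtain x y where v: "v = join_vec x y" by (rule join_vec_cases)
  have "v \<in> ker (B_mat \<alpha> R) \<longleftrightarrow> x \<in> ker (cmat (b ** R ** b))"
    by (simp add: v ker_def B_mat_def block_mat_vec join_vec_zero b_def[symmetric] a_def[symmetric])
  also have "\<dots> \<longleftrightarrow> v \<in> {v. cmat pb *v v = v}" by (simp add: k_props v pb_vec)
  finally show "v \<in> ker (B_mat \<alpha> R) \<longleftrightarrow> v \<in> {v. cmat pb *v v = v}" .
qed

lemma P_B: "P_B \<alpha> R = cmat pb"
  unfolding P_B_def ker_B
  by (rule orth_proj_symmetric_idempotent)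
    (simp_all add: pb_def block_mat_mult transpose_block_mat k_props transpose_arith)

lemma M_vec: "M *v join_vec x y = join_vec
    ((-2 * \<i>) *s (cmat k *v (cmat b *v (cmat \<theta> *v (cmat b *v (cmat k *v x))))) - \<i> *s (cmat k *v (cmat b *v (cmat e *v y))))
    (\<i> *s (cmat e *v (cmat b *v (cmat k *v x))))"
proof -
  have t: "transpose (e ** b) = b ** e" by (simp add: matrix_transpose_mul te tb)
  show ?thesis
    by (simp add: compressed_Omega_def P_B Omega_mat_def Phi_mat_def t del: cmat_arith(6) flip: a_def b_def e_def)
      (simp add: matvec pb_vec block_mat_vec cmat_mult vec_simps vector_smult_lneg vector_smult_rneg del: cmat_arith(6))
qed

text \<open>Antisymmetry of the real factor makes \<open>M\<close> Hermitian; the imaginary entries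
  then make \<open>M\<close> itself antisymmetric, whence the symmetry of its spectrum.\<close>

lemma M_real: "M = \<i> *\<^sub>m cmat (block_mat (mat (-2) ** (k ** b ** \<theta> ** b ** k)) (- (k ** b ** e)) (e ** b ** k) 0)"
  by (rule block_mat_eqI)
    (simp add: M_vec cmat_block_mat block_mat_vec cmat_mult matvec join_vec_arith vector_smult_rneg vector_smult_lneg)

end

section \<open>Orders of roots under reflection and inversion; Hermitian matrices\<close>

lemma order_factorI:
  fixes p :: "'a::field poly"
  assumes "p = smult c ([:- x, 1:] ^ m * r)" "c \<noteq> 0" "poly r x \<noteq> 0"
  shows "order x p = m"
proof -
  have "[:- x, 1:] ^ m * r \<noteq> 0" using assms(3) by auto
  then show ?thesis
    using assms by (simp add: order_smult order_mult order_power_n_n order_0I)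
qed

lemma order_factorE:
  fixes p :: "'a::field poly"
  assumes "p \<noteq> 0"
  obtains r where "p = [:- x, 1:] ^ order x p * r" "poly r x \<noteq> 0"
  using order_decomp[OF assms, of x] by (auto simp: poly_eq_0_iff_dvd)

lemma order_uminus_even:
  fixes p :: "complex poly"
  assumes "p \<noteq> 0" and even: "\<And>x. poly p (- x) = poly p x"
  shows "order (- x) p = order x p"
proof -
  obtain r where r: "p = [:- x, 1:] ^ order x p * r" "poly r x \<noteq> 0"
    by (rule order_factorE[OF assms(1)])
  have "poly p y = poly (smult ((-1) ^ order x p) ([:- (- x), 1:] ^ order x p * pcompose r [:0, -1:])) y" for y
  proof -
    have "poly p y = (- x - y) ^ order x p * poly r (- y)"
      using even[of y] arg_cong[OF r(1), of "\<lambda>f. poly f (- y)"] by simp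
    also have "(- x - y) ^ order x p = (-1) ^ order x p * (y + x) ^ order x p"
      by (simp add: algebra_simps flip: power_mult_distrib)
    finally show ?thesis by (simp add: poly_pcompose add.commute)
  qed
  then have "p = smult ((-1) ^ order x p) ([:- (- x), 1:] ^ order x p * pcompose r [:0, -1:])"
    by (metis poly_eq_poly_eq_iff ext)
  then show ?thesis by (rule order_factorI) (simp_all add: r(2) poly_pcompose)
qed

text \<open>The \<open>2 * n\<close> powers of the variable \<open>y\<close> are used up exactly:
  \<open>m\<close> of them turn \<open>(1/x - 1/y)^m\<close> into a multiple of
  \<open>(y - x)^m\<close>, and the other \<open>degree r\<close> turn \<open>r (- 1/y)\<close> into
  the polynomial \<open>s\<close>.\<close>

lemma order_reciprocal:
  fixes p f :: "complex poly"
  assumes "f \<noteq> 0" "degree f = 2 * n" and eq: "\<And>x. x \<noteq> 0 \<Longrightarrow> poly p x = (- (x\<^sup>2)) ^ n * poly f (- inverse x)"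
    and "x \<noteq> 0"
  shows "order x p = order (- inverse x) f"
proof -
  define m where "m = order (- inverse x) f"
  obtain r where r: "f = [:inverse x, 1:] ^ m * r" "poly r (- inverse x) \<noteq> 0"
    using order_factorE[OF assms(1), of "- inverse x"] by (auto simp: m_def)
  define s where "s = reflect_poly (pcompose r [:0, -1:])"
  have "r \<noteq> 0" using r(2) by auto
  then have "degree f = m + degree r"
    unfolding r(1) by (subst degree_mult_eq) (simp_all add: degree_power_eq)
  then have deg: "2 * n = m + degree r" using assms(2) by simp
  have s: "poly s y = y ^ degree r * poly r (- inverse y)" if "y \<noteq> 0" for y
    using that by (simp add: s_def poly_reflect_poly_nz poly_pcompose degree_pcompose)
  have "p = smult ((-1) ^ n * inverse x ^ m) ([:- x, 1:] ^ m * s)" (is "_ = ?q")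
  proof (rule poly_eqI_nonzero)
    fix y :: complex assume y: "y \<noteq> 0"
    have "(- (y\<^sup>2)) ^ n = (-1) ^ n * y ^ (2 * n)"
      by (simp add: power_minus[of "y\<^sup>2"] power_mult)
    then have "poly p y = (-1) ^ n * y ^ (2 * n) * (inverse x - inverse y) ^ m * poly r (- inverse y)"
      by (simp add: eq[OF y] r(1))
    also have "\<dots> = (-1) ^ n * (y * (inverse x - inverse y)) ^ m * (y ^ degree r * poly r (- inverse y))"
      by (simp add: deg power_add power_mult_distrib)
    also have "y * (inverse x - inverse y) = inverse x * (y - x)"
      using y \<open>x \<noteq> 0\<close> by (simp add: field_simps)
    finally show "poly p y = poly ?q y"
      by (simp add: s[OF y] power_mult_distrib mult_ac)
  qed
  then show ?thesis
    unfolding m_def[symmetric] by (rule order_factorI) (use \<open>x \<noteq> 0\<close> r(2) s in simp_all)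
qed

text \<open>If \<open>M (M v) = 0\<close>, then \<open><M v, M v> = <v, M (M v)> = 0\<close>; hence
  generalized eigenvectors for \<open>0\<close> are already eigenvectors.\<close>

lemma generalized_kernel_hermitian:
  fixes M :: "complex^'n^'n"
  assumes M: "\<And>x y. cinner (M *v x) y = cinner x (M *v y)"
  shows "eig_mult V ((*v) M) 0 = vec.dim {v \<in> V. M *v v = 0}"
proof -
  have sq: "M *v v = 0" if "M *v (M *v v) = 0" for v
    using M[of v "M *v v"] that by simp
  have "M *v v = 0" if "((*v) M ^^ k) v = 0" for k v
    using that
  proof (induction k)
    case (Suc k)
    show ?case
    proof (cases k)
      case 0
      then show ?thesis using Suc.prems by simp
    next
      case (Suc j)
      then show ?thesis using Suc.IH Suc.prems sq by simp
    qed
  qed simp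
  moreover have "((*v) M ^^ 1) v = 0" if "M *v v = 0" for v using that by simp
  ultimately have "{v \<in> V. \<exists>k. ((\<lambda>w. M *v w - 0 *s w) ^^ k) v = 0} = {v \<in> V. M *v v = 0}"
    by (simp, blast)
  then show ?thesis by (simp add: eig_mult_def)
qed

lemma hermitian_eigenvalue_real:
  fixes M :: "complex^'n^'n"
  assumes M: "\<And>x y. cinner (M *v x) y = cinner x (M *v y)" and "\<mu> \<in> spectrum_on UNIV ((*v) M)"
  shows "\<mu> \<in> \<real>"
proof -
  obtain v where v: "v \<noteq> 0" "M *v v = \<mu> *s v" using assms(2) by (auto simp: spectrum_on_def)
  have "cnj \<mu> * cinner v v = \<mu> * cinner v v"
    using M[of v v] by (simp add: v cinner_arith)
  then show ?thesis using v(1) by (simp add: Reals_cnj_iff)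
qed

context damped_system
begin

lemma ker_R_iff: "x \<in> ker (cmat R) \<longleftrightarrow> cmat q *v x = x"
  by (simp add: q_props(5))

lemma eta_zero_iff: "cmat \<eta> *v x = 0 \<longleftrightarrow> cmat e *v x = 0"
proof
  assume "cmat \<eta> *v x = 0"
  then have "cinner (cmat e *v x) (cmat e *v x) = 0"
    by (simp add: cinner_transpose te eta_vec del: cinner_self_eq_0 cmat_arith(6))
  then show "cmat e *v x = 0" by simp
next
  assume "cmat e *v x = 0"
  then show "cmat \<eta> *v x = 0" by (simp add: eta_vec)
qed

lemma cinner_sym: "cinner (cmat e *v x) y = cinner x (cmat e *v y)"
  "cinner (cmat b *v x) y = cinner x (cmat b *v y)"
  "cinner (cmat k *v x) y = cinner x (cmat k *v y)"
  "cinner (cmat q *v x) y = cinner x (cmat q *v y)"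
  by (simp_all only: cinner_transpose te tb k_props q_props)

text \<open>Up to \<open>b\<close>, the lower left block of \<open>M\<close> tests \<open>e\<close>
  on \<open>ker R\<close> and the upper left one tests the compression of \<open>\<theta>\<close>;
  the upper right block is the adjoint of the lower left one.\<close>

theorem M_eq_0_iff:
  "M = 0 \<longleftrightarrow> ker (cmat R) \<subseteq> ker (cmat \<eta>) \<and> P_R R ** cmat \<theta> ** P_R R = 0"
proof
  assume M: "M = 0"
  have *: "cmat e *v (cmat q *v x) = 0 \<and> cmat q *v (cmat \<theta> *v (cmat q *v x)) = 0" for x
  proof -
    \<comment> \<open>The test vector is chosen so that \<open>b k a q x = q x\<close>.\<close>
    have "M *v join_vec (cmat a *v (cmat q *v x)) (0 :: complex^'n) = 0" using M by simp
    then have "cmat e *v (cmat q *v x) = 0" and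
      kb: "cmat k *v (cmat b *v (cmat \<theta> *v (cmat q *v x))) = 0"
      by (simp_all add: M_vec vec_simps join_vec_zero)
    \<comment> \<open>Multiplying by \<open>q a\<close> undoes the outer \<open>k b\<close> and
      leaves the compression of \<open>\<theta>\<close>.\<close>
    moreover have "cmat q *v (cmat a *v (cmat k *v (cmat b *v y))) = cmat q *v y" for y
      by (simp add: vec_simps)
    ultimately show ?thesis by (metis kb matrix_vector_mult_0_right)
  qed
  then have "P_R R ** cmat \<theta> ** P_R R = 0"
    by (intro matrix_eqI) (simp add: P_R matvec)
  moreover have "ker (cmat R) \<subseteq> ker (cmat \<eta>)"
  proof
    fix x assume "x \<in> ker (cmat R)"
    then have "cmat e *v x = 0" using * by (metis ker_R_iff)
    then show "x \<in> ker (cmat \<eta>)" by (simp add: ker_def eta_zero_iff)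
  qed
  ultimately show "ker (cmat R) \<subseteq> ker (cmat \<eta>) \<and> P_R R ** cmat \<theta> ** P_R R = 0" by simp
next
  assume *: "ker (cmat R) \<subseteq> ker (cmat \<eta>) \<and> P_R R ** cmat \<theta> ** P_R R = 0"
  have eb: "cmat e *v (cmat b *v (cmat k *v x)) = 0" for x
  proof -
    have "cmat b *v (cmat k *v x) \<in> ker (cmat R)" by (simp add: ker_R_iff vec_simps)
    then have "cmat b *v (cmat k *v x) \<in> ker (cmat \<eta>)" using * by blast
    then show ?thesis by (simp add: ker_def eta_zero_iff)
  qed
  have be: "cmat k *v (cmat b *v (cmat e *v y)) = 0" for y
  proof -
    let ?w = "cmat k *v (cmat b *v (cmat e *v y))"
    have "cinner (cmat e *v (cmat b *v (cmat k *v ?w))) y = cinner ?w ?w"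
      by (simp only: cinner_sym)
    then have "cinner ?w ?w = 0" unfolding eb by simp
    then show ?thesis by simp
  qed
  have "cmat k *v (cmat b *v (cmat \<theta> *v (cmat b *v (cmat k *v x)))) = 0" for x
  proof -
    have "(P_R R ** cmat \<theta> ** P_R R) *v (cmat b *v (cmat k *v x)) = 0" using * by simp
    then have "cmat q *v (cmat \<theta> *v (cmat b *v (cmat k *v x))) = 0" by (simp add: P_R matvec vec_simps)
    moreover have "cmat k *v (cmat b *v z) = cmat k *v (cmat b *v (cmat q *v z))" for z
      by (simp add: vec_simps)
    ultimately show ?thesis by (metis matrix_vector_mult_0_right)
  qed
  then show "M = 0"
    by (intro block_mat_eqI) (simp add: M_vec eb be join_vec_zero)
qed

lemma rank_le: "rank R \<le> CARD('n)"
  using rank_bound[of R] by simp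

lemma ker_R_trivial: "ker (cmat R) = {0}" if "rank R = CARD('n)"
proof -
  have "vec.dim (ker (cmat R)) = 0" using q_props(8) that by simp
  moreover have "0 \<in> ker (cmat R)" by (simp add: ker_def)
  ultimately show ?thesis by auto
qed

lemma ker_R_nontrivial: "ker (cmat R) \<noteq> {0}" if "rank R < CARD('n)"
proof
  assume "ker (cmat R) = {0}"
  then have "vec.dim (ker (cmat R)) = 0" by simp
  then show False using q_props(8) that by simp
qed

lemma M_neq_0_iff:
  "M \<noteq> 0 \<longleftrightarrow> rank R < CARD('n) \<and>
    \<not> (ker (cmat R) \<subseteq> ker (cmat \<eta>) \<and> P_R R ** cmat \<theta> ** P_R R = 0)"
proof (cases "rank R < CARD('n)")
  case False
  then have ker: "ker (cmat R) = {0}" using ker_R_trivial rank_le by simp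
  have "cmat q *v x \<in> ker (cmat R)" for x by (simp add: ker_R_iff vec_simps)
  then have "cmat q *v x = 0" for x by (simp add: ker)
  then have "P_R R ** cmat \<theta> ** P_R R = 0" by (intro matrix_eqI) (simp add: P_R matvec)
  then show ?thesis using False ker by (simp add: M_eq_0_iff) (simp add: ker_def)
next
  case True
  then show ?thesis using M_eq_0_iff by blast
qed

lemma M_neq_0_iff_trivial_intersection:
  assumes "ker (cmat R) \<inter> ker (cmat \<eta>) = {0}"
  shows "M \<noteq> 0 \<longleftrightarrow> rank R < CARD('n)"
proof -
  have "\<not> ker (cmat R) \<subseteq> ker (cmat \<eta>)" if "rank R < CARD('n)"
    using ker_R_nontrivial[OF that] assms by auto
  then show ?thesis using M_neq_0_iff by blast
qed

text \<open>The real factor in \<open>M_real\<close> changes sign under transposition: its diagonal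
  block inherits this from \<open>\<theta>\<close>, and its off-diagonal blocks are negative
  transposes of each other.\<close>

lemma M_hermitian: "cinner (M *v x) y = cinner x (M *v y)"
proof -
  let ?W = "block_mat (mat (-2) ** (k ** b ** \<theta> ** b ** k)) (- (k ** b ** e)) (e ** b ** k) 0"
  have "transpose (mat (-2) ** (k ** b ** \<theta> ** b ** k)) = - (mat (-2) ** (k ** b ** \<theta> ** b ** k))"
  proof -
    have "transpose (k ** b ** \<theta> ** b ** k) = k ** b ** (- \<theta>) ** b ** k"
      by (simp add: matrix_transpose_mul k_props tb theta matrix_mul_assoc)
    also have "\<dots> = - (k ** b ** \<theta> ** b ** k)" by (rule matrix_eqI) (simp add: matvec)
    finally have t: "transpose (k ** b ** \<theta> ** b ** k) = - (k ** b ** \<theta> ** b ** k)" .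
    have "transpose (mat c ** X) = mat c ** transpose X" for c :: real and X :: "real^'n^'n"
      by (simp add: vec_eq_iff transpose_def mat_mult_component)
    then show ?thesis by (simp only: t) (rule matrix_eqI, simp add: matvec vector_smult_rneg)
  qed
  then have "transpose ?W = - ?W"
    by (simp add: transpose_block_mat transpose_arith matrix_transpose_mul k_props tb te matrix_mul_assoc)
      (rule block_mat_eqI, simp add: block_mat_vec join_vec_arith)
  then have "cinner (cmat ?W *v x) y = - cinner x (cmat ?W *v y)"
    unfolding cinner_transpose by (simp add: cinner_def sum_negf del: cmat_arith(6))
  then show ?thesis by (simp add: M_real cinner_arith)
qed

lemma pb_idem: "cmat pb *v (cmat pb *v v) = cmat pb *v v"
  by (cases v rule: join_vec_cases) (simp add: pb_vec vec_simps)

lemma pb_M: "cmat pb *v (M *v v) = M *v v" "M *v (cmat pb *v v) = M *v v"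
  by (cases v rule: join_vec_cases; simp add: pb_vec M_vec matvec vec_simps vec.scale)+

lemma pb_M_mult: "cmat pb ** cmat pb = cmat pb" "cmat pb ** M = M" "M ** cmat pb = M"
  by (rule matrix_eqI, simp add: matvec pb_idem pb_M)+

lemma Omega1_eq: "Omega1 \<alpha> \<eta> \<theta> R = (*v) M"
  by (rule ext) (simp add: Omega1_def)

lemma self_adjoint: "self_adjoint_on (ker (B_mat \<alpha> R)) (Omega1 \<alpha> \<eta> \<theta> R)"
  by (auto simp: self_adjoint_on_def ker_B Omega1_eq pb_M M_hermitian)

section \<open>The compressed pencil and the multiplicities of eigenvalues\<close>

definition compression_poly :: "complex poly" where
  "compression_poly = (SOME D. \<forall>x. poly D x = det (mat x ** cmat pb - M + (mat 1 - cmat pb)))"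

lemma poly_compression_poly:
  "poly compression_poly x = det (mat x ** cmat pb - M + (mat 1 - cmat pb))"
proof -
  obtain D where "\<And>x. poly D x = det (mat x ** cmat pb + (mat 1 - cmat pb - M))"
    by (rule ex_poly_det_affine) blast
  then have "\<exists>D. \<forall>x. poly D x = det (mat x ** cmat pb - M + (mat 1 - cmat pb))"
    by (auto simp: algebra_simps)
  from someI_ex[OF this] show ?thesis by (simp add: compression_poly_def)
qed

lemma compression_facts:
  shows spectrum_Omega1: "spectrum_Omega1 \<alpha> \<eta> \<theta> R = {\<mu>. poly compression_poly \<mu> = 0}"
    and mult_Omega1: "mult_Omega1 \<alpha> \<eta> \<theta> R \<mu> = order \<mu> compression_poly"
    and charpoly_M: "poly (charpoly M) x = det (mat x ** (mat 1 - cmat pb) + cmat pb) * poly compression_poly x"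
  using eig_mult_compression[OF pb_M_mult poly_compression_poly]
  by (simp_all add: spectrum_Omega1_def mult_Omega1_def ker_B Omega1_eq)

lemma compressed_pencil_det: "compressed_pencil_det \<alpha> \<eta> \<theta> R x = ker_det R (pencil \<alpha> \<eta> \<theta> R x 0)"
  by (simp add: compressed_pencil_det_def det_on_ker[OF R])

text \<open>The determinant of the compressed pencil is a function at first; a polynomial with the
  same values gives meaning to its degree and to the orders of its zeros.\<close>

definition pencil_poly :: "complex poly" where
  "pencil_poly = (SOME p. \<forall>x. poly p x = compressed_pencil_det \<alpha> \<eta> \<theta> R x)"

lemma poly_pencil_poly: "poly pencil_poly x = compressed_pencil_det \<alpha> \<eta> \<theta> R x"
proof -
  obtain p where p: "\<And>x. poly p x = det ((mat 1 - cmat q - cmat q ** cmat \<eta> ** cmat q) +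
      mat x ** (mat (2 * \<i>) ** cmat q ** cmat \<theta> ** cmat q) + mat (x\<^sup>2) ** (cmat q ** cmat \<alpha> ** cmat q))"
    by (rule ex_poly_det_quadratic) blast
  have "poly p x = compressed_pencil_det \<alpha> \<eta> \<theta> R x" for x
    unfolding p compressed_pencil_det ker_det_def
    by (rule arg_cong[where f = det], rule matrix_eqI) (simp add: matvec P_R pencil_vec mult_ac)
  then have "\<exists>p. \<forall>x. poly p x = compressed_pencil_det \<alpha> \<eta> \<theta> R x" by blast
  from someI_ex[OF this] show ?thesis by (simp add: pencil_poly_def)
qed

lemma det_scale_k: "det (mat x ** cmat k + (mat 1 - cmat k)) = x ^ (CARD('n) - rank R)"
  by (rule k_props(7))

text \<open>The pivot contributes \<open>x ^ CARD('n)\<close>. The Schur complement takes back one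
  power for each dimension of the range of \<open>k\<close>, which is
  \<open>CARD('n) - rank R\<close>.\<close>

lemma compression_poly_schur:
  assumes "x \<noteq> 0"
  shows "poly compression_poly x = x ^ rank R * scaled_det (pencil \<alpha> \<eta> \<theta> R x 0)"
proof -
  let ?K = "cmat k" and ?B = "cmat b" and ?E = "cmat e"
  let ?A = "mat x ** ?K + (mat 1 - ?K) + mat (2 * \<i>) ** (?K ** ?B ** cmat \<theta> ** ?B ** ?K)"
  let ?F = "mat \<i> ** (?K ** ?B ** ?E)" and ?G = "mat (- \<i>) ** (?E ** ?B ** ?K)"
  have "mat x ** cmat pb - M + (mat 1 - cmat pb) = block_mat ?A ?F ?G (mat x)"
    by (rule block_mat_eqI)
      (simp add: matvec pb_vec M_vec block_mat_vec join_vec_arith vector_smult_lneg)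
  then have "poly compression_poly x = x ^ CARD('n) * det (?A - mat (1 / x) ** (?F ** ?G))"
    by (simp add: poly_compression_poly det_schur[OF assms])
  \<comment> \<open>\<open>?F ** ?G\<close> is \<open>k b \<eta> b k\<close>, and
    \<open>b \<alpha> b = 1\<close> accounts for \<open>x k\<close>; so the pencil reappears, with a
    factor \<open>1 / x\<close> on the range of \<open>k\<close>.\<close>
  also have "?A - mat (1 / x) ** (?F ** ?G) = (mat (1 / x) ** ?K + (mat 1 - ?K)) **
      (mat 1 - ?K + ?K ** ?B ** pencil \<alpha> \<eta> \<theta> R x 0 ** ?B ** ?K)"
    using assms by (intro matrix_eqI)
      (simp add: matvec pencil_vec vec_simps alpha_vec eta_vec power2_eq_square vec.scale_right_diff_distrib
        vec.scale_right_distrib vector_smult_lneg vector_smult_rneg)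
  also have "det \<dots> = (1 / x) ^ (CARD('n) - rank R) * scaled_det (pencil \<alpha> \<eta> \<theta> R x 0)"
    by (simp only: det_mul det_scale_k scaled_det_def)
  also have "x ^ CARD('n) * ((1 / x) ^ (CARD('n) - rank R) * scaled_det (pencil \<alpha> \<eta> \<theta> R x 0)) =
      x ^ rank R * scaled_det (pencil \<alpha> \<eta> \<theta> R x 0)"
  proof -
    have "x ^ CARD('n) = x ^ rank R * x ^ (CARD('n) - rank R)"
      using rank_le by (simp flip: power_add)
    then show ?thesis using assms by (simp add: power_divide)
  qed
  finally show ?thesis .
qed

lemma compression_poly_eq:
  "smult (ker_det R (cmat \<alpha>)) compression_poly = monom 1 (rank R) * pencil_poly"
proof (rule poly_eqI_nonzero)
  fix x :: complex assume "x \<noteq> 0"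
  then show "poly (smult (ker_det R (cmat \<alpha>)) compression_poly) x = poly (monom 1 (rank R) * pencil_poly) x"
    using scaled_det_eq[of "pencil \<alpha> \<eta> \<theta> R x 0"]
    by (simp add: compression_poly_schur poly_monom poly_pencil_poly compressed_pencil_det mult_ac)
qed

text \<open>Compared with \<open>compression_poly_eq\<close>, the zero eigenvalue on the orthogonal
  complement of \<open>ker B\<close>, of dimension \<open>rank R\<close>, supplies a second power
  \<open>x ^ rank R\<close>.\<close>

lemma charpoly_M_eq:
  "smult (ker_det R (cmat \<alpha>)) (charpoly M) = monom 1 (2 * rank R) * pencil_poly"
proof (rule poly_eqI_nonzero)
  fix x :: complex assume x: "x \<noteq> 0"
  have "mat x ** (mat 1 - cmat pb) + cmat pb = block_mat (mat x ** (mat 1 - cmat k) + cmat k) 0 0 (mat 1)"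
    by (rule block_mat_eqI) (simp add: matvec pb_vec block_mat_vec join_vec_arith)
  then have "det (mat x ** (mat 1 - cmat pb) + cmat pb) = det (mat x ** (mat 1 - cmat k) + cmat k)"
    by (simp add: det_block_mat_Inl)
  \<comment> \<open>The scalings of the range of \<open>k\<close> and of its complement multiply to
    \<open>mat x\<close>, so the second determinant follows from the first by division.\<close>
  moreover have "det (mat x ** (mat 1 - cmat k) + cmat k) * x ^ (CARD('n) - rank R) = x ^ CARD('n)"
  proof -
    have "(mat x ** (mat 1 - cmat k) + cmat k) ** (mat x ** cmat k + (mat 1 - cmat k)) = mat x"
      by (rule matrix_eqI) (simp add: matvec vec_simps)
    then show ?thesis by (metis det_mul det_mat det_scale_k)
  qed
  moreover have "x ^ CARD('n) = x ^ rank R * x ^ (CARD('n) - rank R)"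
    using rank_le by (simp flip: power_add)
  ultimately have "det (mat x ** (mat 1 - cmat pb) + cmat pb) = x ^ rank R"
    using x by simp
  moreover have "ker_det R (cmat \<alpha>) * poly compression_poly x = x ^ rank R * poly pencil_poly x"
    using arg_cong[OF compression_poly_eq, of "\<lambda>p. poly p x"] by (simp add: poly_monom)
  ultimately have "ker_det R (cmat \<alpha>) * poly (charpoly M) x = x ^ rank R * (x ^ rank R * poly pencil_poly x)"
    by (simp add: charpoly_M mult.left_commute)
  then show "poly (smult (ker_det R (cmat \<alpha>)) (charpoly M)) x = poly (monom 1 (2 * rank R) * pencil_poly) x"
    by (simp add: poly_monom mult_2 power_add)
qed

lemma pencil_poly_nonzero: "pencil_poly \<noteq> 0"
proof
  assume "pencil_poly = 0"
  then have "smult (ker_det R (cmat \<alpha>)) (charpoly M) = 0" using charpoly_M_eq by simp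
  then show False using ker_det_alpha by simp
qed

lemma degree_pencil_poly: "degree pencil_poly = 2 * (CARD('n) - rank R)"
proof -
  have "CARD('n + 'n) = degree (smult (ker_det R (cmat \<alpha>)) (charpoly M))"
    using ker_det_alpha by (simp add: degree_charpoly)
  also have "\<dots> = 2 * rank R + degree pencil_poly"
    unfolding charpoly_M_eq using pencil_poly_nonzero by (simp add: degree_mult_eq degree_monom_eq)
  finally show ?thesis by simp
qed

lemma order_monom: "order x (monom 1 n * p) = (if x = 0 then n else 0) + order x p"
  if "p \<noteq> 0" for p :: "complex poly"
  using that by (simp add: order_mult order_0I poly_monom)

lemma mult_Omega1_eq:
  "mult_Omega1 \<alpha> \<eta> \<theta> R \<mu> = (if \<mu> = 0 then rank R else 0) + order \<mu> pencil_poly"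
proof -
  have "order \<mu> compression_poly = order \<mu> (monom 1 (rank R) * pencil_poly)"
    by (metis compression_poly_eq order_smult ker_det_alpha)
  then show ?thesis by (simp add: mult_Omega1 order_monom pencil_poly_nonzero)
qed

lemma eig_mult_M:
  "eig_mult UNIV ((*v) M) \<mu> = (if \<mu> = 0 then 2 * rank R else 0) + order \<mu> pencil_poly"
proof -
  have "order \<mu> (smult (ker_det R (cmat \<alpha>)) (charpoly M)) = (if \<mu> = 0 then 2 * rank R else 0) + order \<mu> pencil_poly"
    unfolding charpoly_M_eq by (simp add: order_monom pencil_poly_nonzero)
  then show ?thesis using ker_det_alpha by (simp add: order_smult order_charpoly)
qed

text \<open>That \<open>0\<close> always belongs to the spectrum comes from the factor
  \<open>x ^ rank R\<close>, whose exponent is positive.\<close>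

lemma spectrum_Omega1_eq: "spectrum_Omega1 \<alpha> \<eta> \<theta> R = {\<rho>. compressed_pencil_det \<alpha> \<eta> \<theta> R \<rho> = 0} \<union> {0}"
proof -
  have "ker_det R (cmat \<alpha>) * poly compression_poly x = x ^ rank R * compressed_pencil_det \<alpha> \<eta> \<theta> R x" for x
    using arg_cong[OF compression_poly_eq, of "\<lambda>p. poly p x"] by (simp add: poly_monom poly_pencil_poly)
  then have "poly compression_poly x = 0 \<longleftrightarrow> x = 0 \<or> compressed_pencil_det \<alpha> \<eta> \<theta> R x = 0" for x
    using ker_det_alpha rank_pos by (metis mult_eq_0_iff power_eq_0_iff)
  then show ?thesis unfolding spectrum_Omega1 by auto
qed

lemma spectrum_M: "spectrum_on UNIV ((*v) M) = spectrum_Omega1 \<alpha> \<eta> \<theta> R"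
proof -
  have "ker_det R (cmat \<alpha>) * poly (charpoly M) x = x ^ (2 * rank R) * compressed_pencil_det \<alpha> \<eta> \<theta> R x" for x
    using arg_cong[OF charpoly_M_eq, of "\<lambda>p. poly p x"] by (simp add: poly_monom poly_pencil_poly)
  then have "poly (charpoly M) x = 0 \<longleftrightarrow> x = 0 \<or> compressed_pencil_det \<alpha> \<eta> \<theta> R x = 0" for x
    using ker_det_alpha rank_pos by (metis mult_eq_0_iff power_eq_0_iff mult_pos_pos zero_less_numeral)
  then show ?thesis unfolding spectrum_charpoly spectrum_Omega1_eq by auto
qed

lemma det_formula:
  "det_on (ker (B_mat \<alpha> R)) (\<lambda>v. \<rho> *s v - Omega1 \<alpha> \<eta> \<theta> R v) =
    \<rho> ^ rank R * (compressed_pencil_det \<alpha> \<eta> \<theta> R \<rho> / det_on (ker (cmat R)) ((*v) (P_R R ** cmat \<alpha> ** P_R R)))"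
proof -
  have "det_on (ker (B_mat \<alpha> R)) (\<lambda>v. \<rho> *s v - Omega1 \<alpha> \<eta> \<theta> R v) = poly compression_poly \<rho>"
    unfolding ker_B poly_compression_poly
    by (rule det_on_eq_det) (simp_all add: matvec Omega1_eq pb_idem pb_M)
  moreover have "ker_det R (cmat \<alpha>) * poly compression_poly \<rho> = \<rho> ^ rank R * compressed_pencil_det \<alpha> \<eta> \<theta> R \<rho>"
    using arg_cong[OF compression_poly_eq, of "\<lambda>p. poly p \<rho>"] by (simp add: poly_monom poly_pencil_poly)
  ultimately show ?thesis using ker_det_alpha by (simp add: det_on_ker[OF R] field_simps)
qed

text \<open>The extension \<open>?N\<close> by the identity is invertible, and it is the identity
  modulo \<open>ker R\<close>; preimages of vectors of \<open>ker R\<close> therefore lie in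
  \<open>ker R\<close>.\<close>

lemma bij_betw_ker:
  "bij_betw ((*v) (P_R R ** cmat \<alpha> ** P_R R)) (ker (cmat R)) (ker (cmat R))"
proof -
  let ?T = "P_R R ** cmat \<alpha> ** P_R R" and ?N = "mat 1 - P_R R + P_R R ** cmat \<alpha> ** P_R R"
  have det: "det ?N \<noteq> 0" using ker_det_alpha by (simp add: ker_det_def)
  have T: "?T *v v = ?N *v v" if "cmat q *v v = v" for v using that by (simp add: matvec P_R)
  have qN: "cmat q *v (?N *v v) = ?T *v v" "?N *v v - cmat q *v (?N *v v) = v - cmat q *v v" for v
    by (simp_all add: matvec P_R vec_simps)
  have "inj_on ((*v) ?T) (ker (cmat R))"
  proof (rule inj_onI)
    fix x y assume "x \<in> ker (cmat R)" "y \<in> ker (cmat R)" "?T *v x = ?T *v y"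
    then have "?N *v (x - y) = 0" by (simp only: ker_R_iff T matrix_vector_mult_diff_distrib diff_self)
    then show "x = y" using det unfolding det_nz_iff_ker by auto
  qed
  moreover have "(*v) ?T ` ker (cmat R) \<subseteq> ker (cmat R)"
    by (auto simp: ker_R_iff matvec P_R vec_simps)
  moreover have "y \<in> (*v) ?T ` ker (cmat R)" if y: "y \<in> ker (cmat R)" for y
  proof -
    obtain B where "?N ** B = mat 1" using det by (auto simp: invertible_def simp flip: invertible_det_nz)
    then have N: "?N *v (B *v y) = y" by (metis matrix_vector_mul_assoc matrix_vector_mul_lid)
    then have "B *v y - cmat q *v (B *v y) = 0" using qN(2)[of "B *v y"] y by (simp add: ker_R_iff)
    then have "cmat q *v (B *v y) = B *v y" by simp
    then show ?thesis using T[of "B *v y"] N by (intro image_eqI[of _ _ "B *v y"]) (simp_all add: ker_R_iff)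
  qed
  ultimately show ?thesis by (auto simp: bij_betw_def)
qed

text \<open>\<open>M\<close> is Hermitian with imaginary entries, hence antisymmetric. Transposition
  gives \<open>det (x - M) = det (x + M)\<close>, and the even size of \<open>M\<close> absorbs the
  remaining sign.\<close>

lemma charpoly_M_even: "poly (charpoly M) (- x) = poly (charpoly M) x"
proof -
  have "transpose M = - M"
  proof -
    have "M $ i $ j = - M $ j $ i" for i j
    proof -
      have re: "cnj (M $ i $ j) = - M $ i $ j" for i j by (simp add: M_real smult_mat_def cmat_def)
      have "cinner (M *v axis j 1) (axis i 1) = cinner (axis j 1) (M *v axis i 1)" by (rule M_hermitian)
      moreover have "cinner v (axis i 1) = cnj (v $ i)" "cinner (axis j 1) v = v $ j" for v :: "complex^('n + 'n)"
        by (simp_all add: cinner_def axis_def if_distrib[of "\<lambda>c. _ * c"] if_distrib[of "\<lambda>c. c * _"] if_distrib[of cnj] cong: if_cong)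
      moreover have "(M *v axis i 1) $ j = M $ j $ i" for i j
        by (simp add: matrix_vector_mult_def axis_def if_distrib[of "\<lambda>c. _ * c"] cong: if_cong)
      ultimately show ?thesis by (metis re minus_minus)
    qed
    note anti = this
    show ?thesis unfolding vec_eq_iff transpose_def
      by (intro allI) (simp only: vec_lambda_beta vector_uminus_component, rule anti)
  qed
  then have "transpose (mat x - M) = mat x + M" by (simp add: transpose_arith)
  also have "\<dots> = mat (-1) ** (mat (- x) - M)"
    by (rule matrix_eqI) (simp add: matvec vector_smult_lneg vector_smult_rneg)
  finally have "det (transpose (mat x - M)) = det (mat (-1) ** (mat (- x) - M))" by (rule arg_cong)
  moreover have "(-1 :: complex) ^ CARD('n + 'n) = 1" by (simp add: power_add flip: power_mult_distrib)
  ultimately show ?thesis by (simp add: poly_charpoly det_mul det_mat del: card_sum)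
qed

lemma eig_mult_M_uminus: "eig_mult UNIV ((*v) M) (- \<mu>) = eig_mult UNIV ((*v) M) \<mu>"
  unfolding order_charpoly[symmetric] by (rule order_uminus_even) (simp_all add: charpoly_M_even)

lemma spectrum_M_uminus: "- \<mu> \<in> spectrum_on UNIV ((*v) M) \<longleftrightarrow> \<mu> \<in> spectrum_on UNIV ((*v) M)"
  by (simp add: spectrum_charpoly charpoly_M_even)

lemma spectrum_M_real: "spectrum_on UNIV ((*v) M) \<subseteq> \<real>"
  using hermitian_eigenvalue_real M_hermitian by blast

text \<open>At \<open>0\<close> the pencil is \<open>- \<eta>\<close>. For \<open>x\<close> in
  \<open>ker R\<close> with \<open>q \<eta> x = 0\<close> one has
  \<open><e x, e x> = <x, \<eta> x> = 0\<close>, so semidefiniteness forces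
  \<open>\<eta> x = 0\<close>.\<close>

lemma ker_intersection_iff: "poly pencil_poly 0 \<noteq> 0 \<longleftrightarrow> ker (cmat R) \<inter> ker (cmat \<eta>) = {0}"
proof -
  let ?N = "mat 1 - cmat q - cmat q ** cmat \<eta> ** cmat q"
  have "mat 1 - P_R R + P_R R ** pencil \<alpha> \<eta> \<theta> R 0 0 ** P_R R = ?N"
    by (rule matrix_eqI) (simp add: matvec P_R pencil_vec)
  then have "poly pencil_poly 0 \<noteq> 0 \<longleftrightarrow> (\<forall>x. ?N *v x = 0 \<longrightarrow> x = 0)"
    by (simp only: poly_pencil_poly compressed_pencil_det ker_det_def det_nz_iff_ker)
  moreover have "?N *v x = 0 \<longleftrightarrow> x \<in> ker (cmat R) \<inter> ker (cmat \<eta>)" for x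
  proof
    assume N: "?N *v x = 0"
    then have "cmat q *v (?N *v x) = 0" by simp
    then have qe: "cmat q *v (cmat \<eta> *v (cmat q *v x)) = 0" by (simp add: matvec vec_simps)
    then have x: "cmat q *v x = x" using N by (simp add: matvec)
    have "cinner (cmat e *v x) (cmat e *v x) = cinner (cmat q *v x) (cmat \<eta> *v x)"
      by (simp add: x cinner_transpose te eta_vec del: cinner_self_eq_0 cmat_arith(6))
    also have "\<dots> = cinner x (cmat q *v (cmat \<eta> *v x))"
      by (rule cinner_sym)
    also have "\<dots> = 0" using qe by (simp add: x)
    finally show "x \<in> ker (cmat R) \<inter> ker (cmat \<eta>)"
      using x by (simp add: ker_R_iff) (simp add: ker_def eta_zero_iff)
  next
    assume "x \<in> ker (cmat R) \<inter> ker (cmat \<eta>)"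
    then have "cmat q *v x = x" "cmat \<eta> *v x = 0" using ker_R_iff by (auto simp: ker_def[of "cmat \<eta>"])
    then show "?N *v x = 0" by (simp add: matvec)
  qed
  moreover have "0 \<in> ker (cmat R) \<inter> ker (cmat \<eta>)" by (simp add: ker_def)
  ultimately show ?thesis by auto
qed

lemma mult_Omega1_0_iff: "mult_Omega1 \<alpha> \<eta> \<theta> R 0 = rank R \<longleftrightarrow> ker (cmat R) \<inter> ker (cmat \<eta>) = {0}"
  by (simp add: mult_Omega1_eq order_eq_0_iff[OF pencil_poly_nonzero] ker_intersection_iff)

lemma range_Omega1: "Omega1 \<alpha> \<eta> \<theta> R ` ker (B_mat \<alpha> R) = range ((*v) M)"
proof -
  have "M *v v \<in> (*v) M ` {v. cmat pb *v v = v}" for v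
    by (rule image_eqI[of _ _ "cmat pb *v v"]) (simp_all add: pb_M pb_idem)
  then show ?thesis by (auto simp: Omega1_eq ker_B)
qed

text \<open>Since \<open>M\<close> is Hermitian, kernel dimensions equal the multiplicities of
  \<open>0\<close>: \<open>rank R\<close> on \<open>ker B\<close> and \<open>2 * rank R\<close> on
  the whole space.\<close>

lemma dims_trivial_intersection:
  assumes "ker (cmat R) \<inter> ker (cmat \<eta>) = {0}"
  shows "vec.dim {v \<in> ker (B_mat \<alpha> R). Omega1 \<alpha> \<eta> \<theta> R v = 0} = rank R"
    and "vec.dim (range ((*v) M)) = 2 * (CARD('n) - rank R)"
proof -
  have p0: "order 0 pencil_poly = 0"
    using assms by (simp add: order_eq_0_iff[OF pencil_poly_nonzero] ker_intersection_iff)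
  have "vec.dim {v. M *v v = 0} = 2 * rank R"
    using generalized_kernel_hermitian[OF M_hermitian, of UNIV] by (simp add: eig_mult_M p0)
  then show "vec.dim (range ((*v) M)) = 2 * (CARD('n) - rank R)"
    by (simp add: dim_range_matrix)
  have "mult_Omega1 \<alpha> \<eta> \<theta> R 0 = vec.dim {v \<in> ker (B_mat \<alpha> R). M *v v = 0}"
    using generalized_kernel_hermitian[OF M_hermitian] by (simp add: mult_Omega1_def Omega1_eq)
  then show "vec.dim {v \<in> ker (B_mat \<alpha> R). Omega1 \<alpha> \<eta> \<theta> R v = 0} = rank R"
    by (simp add: mult_Omega1_eq p0 Omega1_eq)
qed

end

section \<open>Interchanging the two matrices\<close>

text \<open>Inversion reverses the order of positive numbers. \<open>S\<close> may have other
  elements too; one positive element suffices for \<open>Max S > 0\<close>.\<close>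

lemma Min_eq_inverse_Max:
  fixes S T :: "real set"
  assumes fin: "finite S" "finite T" and inv: "\<And>x. x > 0 \<Longrightarrow> x \<in> S \<longleftrightarrow> inverse x \<in> T"
    and pos: "\<exists>x>0. x \<in> S"
  shows "Min {x \<in> T. 0 < x} = inverse (Max S)"
proof (rule Min_eqI)
  show "finite {x \<in> T. 0 < x}" using fin by simp
  obtain x where x: "x > 0" "x \<in> S" using pos by blast
  have m: "Max S \<in> S" using fin x by (intro Max_in) auto
  have m0: "Max S > 0" using fin x Max_ge[of S x] by linarith
  show "inverse (Max S) \<in> {x \<in> T. 0 < x}" using inv[OF m0] m m0 by simp
  fix y assume y: "y \<in> {x \<in> T. 0 < x}"
  then have "inverse y \<in> S" using inv[of "inverse y"] by simp
  then have "inverse y \<le> Max S" using fin by simp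
  then show "inverse (Max S) \<le> y" using y by (metis (no_types, lifting) inverse_inverse_eq le_imp_inverse_le inverse_positive_iff_positive mem_Collect_eq)
qed

lemma pencil_flat:
  assumes "\<rho> \<noteq> 0"
  shows "pencil \<alpha> \<eta> \<theta> R \<rho> 0 *v v = - \<rho>\<^sup>2 *s (pencil \<eta> \<alpha> \<theta> R (- inverse \<rho>) 0 *v v)"
proof -
  have "(pencil \<alpha> \<eta> \<theta> R \<rho> 0 *v v) $ i = (- \<rho>\<^sup>2 *s (pencil \<eta> \<alpha> \<theta> R (- inverse \<rho>) 0 *v v)) $ i" for i
    using assms by (simp add: pencil_vec field_simps power2_eq_square)
  then show ?thesis by (simp add: vec_eq_iff)
qed

context damped_system
begin

lemma zero_in_spectrum: "0 \<in> spectrum_Omega1 \<alpha> \<eta> \<theta> R"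
  by (simp add: spectrum_Omega1_eq)

lemma finite_spectrum_Omega1: "finite (spectrum_Omega1 \<alpha> \<eta> \<theta> R)"
  unfolding spectrum_M[symmetric] by (rule finite_spectrum)

lemma spectrum_Omega1_uminus: "- \<mu> \<in> spectrum_Omega1 \<alpha> \<eta> \<theta> R \<longleftrightarrow> \<mu> \<in> spectrum_Omega1 \<alpha> \<eta> \<theta> R"
  using spectrum_M_uminus by (simp add: spectrum_M)

lemma finite_real_spectrum: "finite {x. complex_of_real x \<in> spectrum_Omega1 \<alpha> \<eta> \<theta> R}"
  using finite_vimageI[OF finite_spectrum_Omega1, of complex_of_real] by (simp add: vimage_def inj_of_real)

end

locale positive_system = damped_system \<alpha> \<eta> \<theta> R for \<alpha> \<eta> \<theta> R :: "real^'n^'n" +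
  assumes eta_pos: "pos_def \<eta>"
begin

lemma flat: "damped_system \<eta> \<alpha> \<theta> R"
  by unfold_locales (rule alpha eta theta R rank_pos alpha_psd eta_pos)+

sublocale flat: damped_system \<eta> \<alpha> \<theta> R
  by (rule flat)

lemma trivial_intersection: "ker (cmat R) \<inter> ker (cmat \<eta>) = {0}"
  by (simp add: ker_cmat_pos_def[OF eta_pos]) (simp add: ker_def)

lemma trivial_intersection_flat: "ker (cmat R) \<inter> ker (cmat \<alpha>) = {0}"
  by (simp add: ker_cmat_pos_def[OF alpha(2)]) (simp add: ker_def)

text \<open>One factor \<open>- x^2\<close> arises for each dimension of
  \<open>ker R\<close>.\<close>

lemma pencil_poly_flat:
  assumes "x \<noteq> 0"
  shows "poly pencil_poly x = (- (x\<^sup>2)) ^ (CARD('n) - rank R) * poly flat.pencil_poly (- inverse x)"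
proof -
  let ?C = "pencil \<eta> \<alpha> \<theta> R (- inverse x) 0"
  have "mat 1 - P_R R + P_R R ** pencil \<alpha> \<eta> \<theta> R x 0 ** P_R R =
      (mat (- (x\<^sup>2)) ** cmat q + (mat 1 - cmat q)) ** (mat 1 - P_R R + P_R R ** ?C ** P_R R)"
    by (rule matrix_eqI) (simp add: P_R matvec vec_simps pencil_flat[OF assms, of \<alpha> \<eta>])
  from arg_cong[OF this, of det] show ?thesis
    by (simp only: poly_pencil_poly flat.poly_pencil_poly compressed_pencil_det flat.compressed_pencil_det
        ker_det_def det_mul q_props(7))
qed

lemma mult_Omega1_flat:
  assumes "x \<noteq> 0"
  shows "mult_Omega1 \<alpha> \<eta> \<theta> R x = mult_Omega1 \<eta> \<alpha> \<theta> R (- inverse x)"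
proof -
  have "order x pencil_poly = order (- inverse x) flat.pencil_poly"
    by (rule order_reciprocal[OF flat.pencil_poly_nonzero flat.degree_pencil_poly pencil_poly_flat assms])
  then show ?thesis using assms by (simp add: mult_Omega1_eq flat.mult_Omega1_eq)
qed

lemma spectrum_Omega1_flat:
  assumes "x \<noteq> 0"
  shows "x \<in> spectrum_Omega1 \<alpha> \<eta> \<theta> R \<longleftrightarrow> - inverse x \<in> spectrum_Omega1 \<eta> \<alpha> \<theta> R"
  using assms pencil_poly_flat[OF assms]
  by (simp add: spectrum_Omega1_eq flat.spectrum_Omega1_eq poly_pencil_poly flat.poly_pencil_poly)

text \<open>The minus sign of the reciprocal is removed by the symmetry of the interchanged spectrum
  about \<open>0\<close>.\<close>

lemma real_spectrum_flat:
  assumes "x > 0"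
  shows "complex_of_real x \<in> spectrum_Omega1 \<alpha> \<eta> \<theta> R \<longleftrightarrow>
    complex_of_real (inverse x) \<in> spectrum_Omega1 \<eta> \<alpha> \<theta> R"
  using assms by (simp add: spectrum_Omega1_flat flat.spectrum_Omega1_uminus)

text \<open>Rank deficiency makes the degree of \<open>pencil_poly\<close> positive, so it has a
  root; trivial intersection of the kernels excludes \<open>0\<close>, and a real root may be
  replaced by its absolute value.\<close>

lemma ex_positive_eigenvalue:
  assumes "rank R < CARD('n)"
  shows "\<exists>x>0. complex_of_real x \<in> spectrum_Omega1 \<alpha> \<eta> \<theta> R"
proof -
  have "\<not> constant (poly pencil_poly)"
    using assms by (simp add: constant_degree degree_pencil_poly)
  then obtain z where z: "poly pencil_poly z = 0" using fundamental_theorem_of_algebra by blast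
  then have "z \<noteq> 0" using ker_intersection_iff trivial_intersection by metis
  have zs: "z \<in> spectrum_Omega1 \<alpha> \<eta> \<theta> R" using z by (simp add: spectrum_Omega1_eq poly_pencil_poly)
  then have "z \<in> \<real>" using spectrum_M_real by (auto simp: spectrum_M)
  then obtain x where x: "z = complex_of_real x" by (auto elim: Reals_cases)
  then have "complex_of_real \<bar>x\<bar> \<in> spectrum_Omega1 \<alpha> \<eta> \<theta> R"
    using zs spectrum_Omega1_uminus[of z] by (simp add: abs_if)
  then show ?thesis using \<open>z \<noteq> 0\<close> x by (intro exI[of _ "\<bar>x\<bar>"]) simp
qed

lemma rho_min_flat:
  assumes "rank R < CARD('n)"
  shows "rho_min \<eta> \<alpha> \<theta> R = inverse (rho_max \<alpha> \<eta> \<theta> R)"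
  using Min_eq_inverse_Max[OF finite_real_spectrum flat.finite_real_spectrum] real_spectrum_flat
    ex_positive_eigenvalue[OF assms]
  by (simp add: rho_min_def rho_max_def)

end

theorem proposition23:
  fixes \<alpha> \<eta> \<theta> R :: "real^'n^'n"
  assumes "transpose \<alpha> = \<alpha>" and "pos_def \<alpha>"
    and "transpose \<eta> = \<eta>" and "pos_semidef \<eta>"
    and "transpose \<theta> = - \<theta>"
    and "transpose R = R" and "pos_semidef R"
    and "rank R > 0"
  shows
    (* For rank R < N the compression can vanish, e.g. for \<eta> = 0 and \<theta> = 0; it does so exactly
       under the negated condition below, which is impossible when ker R and ker \<eta> meet
       trivially (in particular when \<eta> > 0) and R is
       rank deficient. *)
    "(compressed_Omega \<alpha> \<eta> \<theta> R \<noteq> 0 \<longleftrightarrow>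
        rank R < CARD('n) \<and>
        \<not> (ker (cmat R) \<subseteq> ker (cmat \<eta>) \<and> P_R R ** cmat \<theta> ** P_R R = 0)) \<and>
     (ker (cmat R) \<inter> ker (cmat \<eta>) = {0} \<longrightarrow>
        (compressed_Omega \<alpha> \<eta> \<theta> R \<noteq> 0 \<longleftrightarrow> rank R < CARD('n))) \<and>
     (rank R < CARD('n) \<longrightarrow>
       ((\<forall>\<mu>\<in>spectrum_on UNIV ((*v) (compressed_Omega \<alpha> \<eta> \<theta> R)). \<mu> \<noteq> 0 \<longrightarrow>
           \<mu> \<in> \<real> \<and>
           - \<mu> \<in> spectrum_on UNIV ((*v) (compressed_Omega \<alpha> \<eta> \<theta> R)) \<and>
           eig_mult UNIV ((*v) (compressed_Omega \<alpha> \<eta> \<theta> R)) (- \<mu>) =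
           eig_mult UNIV ((*v) (compressed_Omega \<alpha> \<eta> \<theta> R)) \<mu>) \<and>
        0 \<in> spectrum_on UNIV ((*v) (compressed_Omega \<alpha> \<eta> \<theta> R)) \<and>
        spectrum_on UNIV ((*v) (compressed_Omega \<alpha> \<eta> \<theta> R)) =
          uminus ` spectrum_on UNIV ((*v) (compressed_Omega \<alpha> \<eta> \<theta> R)) \<and>
        spectrum_on UNIV ((*v) (compressed_Omega \<alpha> \<eta> \<theta> R)) \<subseteq> \<real>) \<and>
       (self_adjoint_on (ker (B_mat \<alpha> R)) (Omega1 \<alpha> \<eta> \<theta> R) \<and>
        bij_betw ((*v) (P_R R ** cmat \<alpha> ** P_R R)) (ker (cmat R)) (ker (cmat R)) \<and>
        (\<forall>\<rho>. det_on (ker (B_mat \<alpha> R)) (\<lambda>v. \<rho> *s v - Omega1 \<alpha> \<eta> \<theta> R v) =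
              \<rho> ^ rank R *
              (compressed_pencil_det \<alpha> \<eta> \<theta> R \<rho> /
               det_on (ker (cmat R)) ((*v) (P_R R ** cmat \<alpha> ** P_R R)))) \<and>
        spectrum_on UNIV ((*v) (compressed_Omega \<alpha> \<eta> \<theta> R)) = spectrum_Omega1 \<alpha> \<eta> \<theta> R \<and>
        spectrum_Omega1 \<alpha> \<eta> \<theta> R = {\<rho>. compressed_pencil_det \<alpha> \<eta> \<theta> R \<rho> = 0} \<union> {0}) \<and>
       (\<exists>p :: complex poly.
          (\<forall>\<rho>. poly p \<rho> = compressed_pencil_det \<alpha> \<eta> \<theta> R \<rho>) \<and>
          degree p = 2 * CARD('n) - 2 * rank R \<and>
          (\<forall>\<rho>\<^sub>0\<in>spectrum_on UNIV ((*v) (compressed_Omega \<alpha> \<eta> \<theta> R)). \<rho>\<^sub>0 \<noteq> 0 \<longrightarrow>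
             eig_mult UNIV ((*v) (compressed_Omega \<alpha> \<eta> \<theta> R)) \<rho>\<^sub>0 = mult_Omega1 \<alpha> \<eta> \<theta> R \<rho>\<^sub>0 \<and>
             mult_Omega1 \<alpha> \<eta> \<theta> R \<rho>\<^sub>0 = order \<rho>\<^sub>0 p)) \<and>
       ((mult_Omega1 \<alpha> \<eta> \<theta> R 0 = rank R \<longleftrightarrow> ker (cmat R) \<inter> ker (cmat \<eta>) = {0}) \<and>
        (ker (cmat R) \<inter> ker (cmat \<eta>) = {0} \<longrightarrow>
           vec.dim {v \<in> ker (B_mat \<alpha> R). Omega1 \<alpha> \<eta> \<theta> R v = 0} = rank R \<and>
           vec.dim (range ((*v) (compressed_Omega \<alpha> \<eta> \<theta> R))) = 2 * (CARD('n) - rank R) \<and>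
           vec.dim (Omega1 \<alpha> \<eta> \<theta> R ` ker (B_mat \<alpha> R)) = 2 * (CARD('n) - rank R))) \<and>
       (pos_def \<eta> \<longrightarrow>
          (0 \<in> spectrum_Omega1 \<eta> \<alpha> \<theta> R \<and> 0 \<in> spectrum_Omega1 \<alpha> \<eta> \<theta> R \<and>
           mult_Omega1 \<eta> \<alpha> \<theta> R 0 = rank R \<and> mult_Omega1 \<alpha> \<eta> \<theta> R 0 = rank R) \<and>
          (\<forall>\<rho>. \<rho> \<noteq> 0 \<longrightarrow> (\<forall>v\<in>ker (cmat R).
             (P_R R ** pencil \<alpha> \<eta> \<theta> R \<rho> 0 ** P_R R) *v v =
             - \<rho>\<^sup>2 *s ((P_R R ** pencil \<eta> \<alpha> \<theta> R (- inverse \<rho>) 0 ** P_R R) *v v))) \<and>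
          (\<forall>\<rho> m. \<rho> \<noteq> 0 \<longrightarrow>
             (\<rho> \<in> spectrum_Omega1 \<alpha> \<eta> \<theta> R \<and> mult_Omega1 \<alpha> \<eta> \<theta> R \<rho> = m \<longleftrightarrow>
              - inverse \<rho> \<in> spectrum_Omega1 \<eta> \<alpha> \<theta> R \<and> mult_Omega1 \<eta> \<alpha> \<theta> R (- inverse \<rho>) = m)) \<and>
          (finite (spectrum_Omega1 \<alpha> \<eta> \<theta> R) \<and> (\<exists>x>0. complex_of_real x \<in> spectrum_Omega1 \<alpha> \<eta> \<theta> R) \<and>
           finite (spectrum_Omega1 \<eta> \<alpha> \<theta> R) \<and> (\<exists>x>0. complex_of_real x \<in> spectrum_Omega1 \<eta> \<alpha> \<theta> R)) \<and>
          rho_min \<eta> \<alpha> \<theta> R = inverse (rho_max \<alpha> \<eta> \<theta> R) \<and>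
          rho_max \<eta> \<alpha> \<theta> R = inverse (rho_min \<alpha> \<eta> \<theta> R)))"
proof -
  interpret damped_system \<alpha> \<eta> \<theta> R by unfold_locales fact+
  let ?S = "spectrum_on UNIV ((*v) M)"
  have spec: "spectrum_on UNIV ((*v) M) = uminus ` spectrum_on UNIV ((*v) M)"
    using spectrum_M_uminus by (auto simp: image_iff) (metis minus_minus)
  have part1: "(\<forall>\<mu>\<in>?S. \<mu> \<noteq> 0 \<longrightarrow> \<mu> \<in> \<real> \<and> - \<mu> \<in> ?S \<and>
      eig_mult UNIV ((*v) M) (- \<mu>) = eig_mult UNIV ((*v) M) \<mu>) \<and>
      0 \<in> ?S \<and> ?S = uminus ` ?S \<and> ?S \<subseteq> \<real>"
    using spectrum_M_real spectrum_M_uminus eig_mult_M_uminus zero_in_spectrum spec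
    by (auto simp: spectrum_M)
  have part3: "\<exists>p. (\<forall>\<rho>. poly p \<rho> = compressed_pencil_det \<alpha> \<eta> \<theta> R \<rho>) \<and>
      degree p = 2 * CARD('n) - 2 * rank R \<and>
      (\<forall>\<rho>\<^sub>0\<in>?S. \<rho>\<^sub>0 \<noteq> 0 \<longrightarrow> eig_mult UNIV ((*v) M) \<rho>\<^sub>0 = mult_Omega1 \<alpha> \<eta> \<theta> R \<rho>\<^sub>0 \<and>
        mult_Omega1 \<alpha> \<eta> \<theta> R \<rho>\<^sub>0 = order \<rho>\<^sub>0 p)"
    by (rule exI[of _ pencil_poly])
      (simp add: poly_pencil_poly degree_pencil_poly eig_mult_M mult_Omega1_eq diff_mult_distrib2)
  have part5: "(0 \<in> spectrum_Omega1 \<eta> \<alpha> \<theta> R \<and> 0 \<in> spectrum_Omega1 \<alpha> \<eta> \<theta> R \<and>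
           mult_Omega1 \<eta> \<alpha> \<theta> R 0 = rank R \<and> mult_Omega1 \<alpha> \<eta> \<theta> R 0 = rank R) \<and>
          (\<forall>\<rho>. \<rho> \<noteq> 0 \<longrightarrow> (\<forall>v\<in>ker (cmat R).
             (P_R R ** pencil \<alpha> \<eta> \<theta> R \<rho> 0 ** P_R R) *v v =
             - \<rho>\<^sup>2 *s ((P_R R ** pencil \<eta> \<alpha> \<theta> R (- inverse \<rho>) 0 ** P_R R) *v v))) \<and>
          (\<forall>\<rho> m. \<rho> \<noteq> 0 \<longrightarrow>
             (\<rho> \<in> spectrum_Omega1 \<alpha> \<eta> \<theta> R \<and> mult_Omega1 \<alpha> \<eta> \<theta> R \<rho> = m \<longleftrightarrow>
              - inverse \<rho> \<in> spectrum_Omega1 \<eta> \<alpha> \<theta> R \<and> mult_Omega1 \<eta> \<alpha> \<theta> R (- inverse \<rho>) = m)) \<and>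
          (finite (spectrum_Omega1 \<alpha> \<eta> \<theta> R) \<and> (\<exists>x>0. complex_of_real x \<in> spectrum_Omega1 \<alpha> \<eta> \<theta> R) \<and>
           finite (spectrum_Omega1 \<eta> \<alpha> \<theta> R) \<and> (\<exists>x>0. complex_of_real x \<in> spectrum_Omega1 \<eta> \<alpha> \<theta> R)) \<and>
          rho_min \<eta> \<alpha> \<theta> R = inverse (rho_max \<alpha> \<eta> \<theta> R) \<and>
          rho_max \<eta> \<alpha> \<theta> R = inverse (rho_min \<alpha> \<eta> \<theta> R)"
    if "rank R < CARD('n)" "pos_def \<eta>"
  proof -
    interpret pos: positive_system \<alpha> \<eta> \<theta> R by unfold_locales fact
    \<comment> \<open>The identity for the other extremal eigenvalue is \<open>rho_min_flat\<close>
      with the two matrices exchanged, solved for \<open>rho_max\<close>.\<close>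
    interpret swapped: positive_system \<eta> \<alpha> \<theta> R
      using pos.flat assms(2) by (simp add: positive_system_def positive_system_axioms_def)
    have "(P_R R ** pencil \<alpha> \<eta> \<theta> R \<rho> 0 ** P_R R) *v v =
        - \<rho>\<^sup>2 *s ((P_R R ** pencil \<eta> \<alpha> \<theta> R (- inverse \<rho>) 0 ** P_R R) *v v)" if "\<rho> \<noteq> 0" for \<rho> v
      by (simp add: matvec pencil_flat[OF that, of \<alpha> \<eta>])
    then show ?thesis
      using zero_in_spectrum pos.flat.zero_in_spectrum mult_Omega1_0_iff pos.flat.mult_Omega1_0_iff
        pos.trivial_intersection pos.trivial_intersection_flat pos.spectrum_Omega1_flat pos.mult_Omega1_flat
        finite_spectrum_Omega1 pos.flat.finite_spectrum_Omega1
        pos.ex_positive_eigenvalue[OF that(1)] swapped.ex_positive_eigenvalue[OF that(1)]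
        pos.rho_min_flat[OF that(1)] swapped.rho_min_flat[OF that(1)]
      by simp
  qed
  have part2: "self_adjoint_on (ker (B_mat \<alpha> R)) (Omega1 \<alpha> \<eta> \<theta> R) \<and>
        bij_betw ((*v) (P_R R ** cmat \<alpha> ** P_R R)) (ker (cmat R)) (ker (cmat R)) \<and>
        (\<forall>\<rho>. det_on (ker (B_mat \<alpha> R)) (\<lambda>v. \<rho> *s v - Omega1 \<alpha> \<eta> \<theta> R v) =
              \<rho> ^ rank R *
              (compressed_pencil_det \<alpha> \<eta> \<theta> R \<rho> /
               det_on (ker (cmat R)) ((*v) (P_R R ** cmat \<alpha> ** P_R R)))) \<and>
        ?S = spectrum_Omega1 \<alpha> \<eta> \<theta> R \<and>
        spectrum_Omega1 \<alpha> \<eta> \<theta> R = {\<rho>. compressed_pencil_det \<alpha> \<eta> \<theta> R \<rho> = 0} \<union> {0}"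
    by (intro conjI allI self_adjoint bij_betw_ker det_formula spectrum_M spectrum_Omega1_eq)
  have part4: "(mult_Omega1 \<alpha> \<eta> \<theta> R 0 = rank R \<longleftrightarrow> ker (cmat R) \<inter> ker (cmat \<eta>) = {0}) \<and>
        (ker (cmat R) \<inter> ker (cmat \<eta>) = {0} \<longrightarrow>
           vec.dim {v \<in> ker (B_mat \<alpha> R). Omega1 \<alpha> \<eta> \<theta> R v = 0} = rank R \<and>
           vec.dim (range ((*v) M)) = 2 * (CARD('n) - rank R) \<and>
           vec.dim (Omega1 \<alpha> \<eta> \<theta> R ` ker (B_mat \<alpha> R)) = 2 * (CARD('n) - rank R))"
    unfolding range_Omega1 by (intro conjI impI mult_Omega1_0_iff dims_trivial_intersection)
  show ?thesis
    by (rule conjI[OF M_neq_0_iff conjI], rule impI, erule M_neq_0_iff_trivial_intersection, rule impI,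
        rule conjI[OF part1 conjI[OF part2 conjI[OF part3 conjI[OF part4 impI]]]], rule part5)
qed

end
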